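(* Let $K=\mathbb{R}$ or $K=\mathbb{C}$, let $d=2$, and put $k=1$ if $K=\mathbb{R}$ and $k=2$ if $K=\mathbb{C}$. The affine-invariant distance $\operatorname{dist}$ on $\mathcal{S}$ can be normalized (by a choice of its multiplicative constant) such that for all $\Sigma\in\mathcal{P}_2(K)$, all $n\in\mathbb{N}$ with $n>2$, and all $x\in\mathcal{S}$, $$f_{P\mathcal{W}}(x;\Sigma,n)\propto \cosh\big(\operatorname{dist}(x,\bar\Sigma)\big)^{-kn},$$ where $\propto$ means equality up to a positive multiplicative constant not depending on $x$.
   Context: $\mathcal{P}_2(K)$ is the set of $2\times 2$ symmetric positive definite real matrices if $K=\mathbb{R}$, and of $2\times 2$ Hermitian positive definite complex matrices if $K=\mathbb{C}$. $A^*$ denotes the transpose ($K=\mathbb{R}$) or conjugate transpose ($K=\mathbb{C}$) of $A$. Wishart distribution: for $\Sigma\in\mathcal{P}_2(K)$ and $n\ge 2$, let $Y_1,\dots,Y_n$ be i.i.d. column vectors in $K^2$ with Gaussian law of mean $0$ and covariance $\Sigma$ (for $K=\mathbb{C}$, the circularly symmetric complex Gaussian with $E[YY^*]=\Sigma$). $\mathcal{W}(\Sigma,n)$ is the law of $\sum_{i=1}^n Y_iY_i^*$, which lies in $\mathcal{P}_2(K)$ almost surely. Projective Wishart distribution: let $\mathcal{S}=\{X\in\mathcal{P}_2(K):\det(X)=1\}$ and let $\pi:\mathcal{P}_2(K)\to\mathcal{S}$, $\pi(X)=\det(X)^{-1/2}X$. Write $\bar\Sigma=\pi(\Sigma)$.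 $P\mathcal{W}(\Sigma,n)$ is the law on $\mathcal{S}$ of $\pi(X)$ when $X\sim\mathcal{W}(\Sigma,n)$. Affine-invariant distance on $\mathcal{S}$, defined up to a multiplicative constant $c>0$: $\operatorname{dist}(x,y)=c\,\|\log(x^{-1/2}yx^{-1/2})\|$, with $\|\cdot\|$ the Frobenius norm and $\log$ the matrix logarithm. "Normalized" means choosing $c$. Density: $SL_2(K)$ acts on $\mathcal{S}$ by $G\cdot x=GxG^*$. Up to a multiplicative factor there is a unique volume measure on $\mathcal{S}$ invariant under this action; fix such a measure $\nu$. $f_{P\mathcal{W}}(\cdot;\Sigma,n):\mathcal{S}\to\mathbb{R}$ is the density of $P\mathcal{W}(\Sigma,n)$ with respect to $\nu$, i.e. $P\mathcal{W}(\Sigma,n)(A)=\int_A f_{P\mathcal{W}}(x;\Sigma,n)\,\mathrm{d}\nu(x)$ for every measurable $A\subset\mathcal{S}$, chosen to be continuous. *)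

theory Defs
  imports "HOL-Probability.Probability"
begin

class real_or_complex = real_normed_field + euclidean_space +
  fixes rc_cnj :: "'a \<Rightarrow> 'a"
    and rc_re :: "'a \<Rightarrow> real"
  assumes rc_cnj_cnj: "rc_cnj (rc_cnj x) = x"
    and rc_cnj_add: "rc_cnj (x + y) = rc_cnj x + rc_cnj y"
    and rc_cnj_mult: "rc_cnj (x * y) = rc_cnj x * rc_cnj y"
    and rc_add_cnj: "x + rc_cnj x = (2 * rc_re x) *\<^sub>R 1"
    and rc_mult_cnj: "x * rc_cnj x = (norm x)\<^sup>2 *\<^sub>R 1"
    and rc_inner_eq: "x \<bullet> y = rc_re (rc_cnj x * y)"

instantiation real :: real_or_complex
begin
definition rc_cnj_real :: "real \<Rightarrow> real" where "rc_cnj_real x = x"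
definition rc_re_real :: "real \<Rightarrow> real" where "rc_re_real x = x"
instance
  by standard (simp_all add: rc_cnj_real_def rc_re_real_def power2_eq_square)
end

instantiation complex :: real_or_complex
begin
definition rc_cnj_complex :: "complex \<Rightarrow> complex" where "rc_cnj_complex = cnj"
definition rc_re_complex :: "complex \<Rightarrow> real" where "rc_re_complex = Re"
instance
proof
  fix x y :: complex
  show "x * rc_cnj x = (norm x)\<^sup>2 *\<^sub>R 1"
    by (simp add: rc_cnj_complex_def complex_norm_square scaleR_conv_of_real del: of_real_power)
  show "x + rc_cnj x = (2 * rc_re x) *\<^sub>R 1"
    by (simp add: rc_cnj_complex_def rc_re_complex_def complex_eq_iff)
qed (simp_all add: rc_cnj_complex_def rc_re_complex_def inner_complex_def)
end

definition adj :: "'k::real_or_complex^2^2 \<Rightarrow> 'k^2^2" where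
  "adj A = (\<chi> i j. rc_cnj (A $ j $ i))"

definition hermitian :: "'k::real_or_complex^2^2 \<Rightarrow> bool" where
  "hermitian A \<longleftrightarrow> adj A = A"

text \<open>The inner product on \<open>'k^2\<close> is the real one, so that \<open>y \<bullet> (A *v y)\<close> is the real part of
  \<open>y\<^sup>* A y\<close>, which is already real when \<open>A\<close> is Hermitian.\<close>

definition pos_def :: "('k::real_or_complex^2^2) set" where
  "pos_def = {A. hermitian A \<and> (\<forall>y. y \<noteq> 0 \<longrightarrow> y \<bullet> (A *v y) > 0)}"

definition pos_def_det1 :: "('k::real_or_complex^2^2) set" where
  "pos_def_det1 = {X \<in> pos_def. det X = 1}"

definition proj_det1 :: "'k::real_or_complex^2^2 \<Rightarrow> 'k^2^2" where
  "proj_det1 X = (rc_re (det X) powr (-1/2)) *\<^sub>R X"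

text \<open>With \<open>k = DIM('k)\<close>, the density below is
  \<open>(2\<pi>)\<^sup>-\<^sup>1 det(\<Sigma>)\<^sup>-\<^sup>1\<^sup>/\<^sup>2 exp(- y\<^sup>T \<Sigma>\<^sup>-\<^sup>1 y / 2)\<close> in the real case (covariance \<open>\<Sigma>\<close>) and
  \<open>\<pi>\<^sup>-\<^sup>2 det(\<Sigma>)\<^sup>-\<^sup>1 exp(- y\<^sup>* \<Sigma>\<^sup>-\<^sup>1 y)\<close> in the complex case (circularly symmetric, with
  \<open>E[Y Y\<^sup>*] = \<Sigma>\<close>).\<close>

definition gaussian :: "'k::real_or_complex^2^2 \<Rightarrow> ('k^2) measure" where
  "gaussian \<Sigma> = density lborel (\<lambda>y. ennreal (
     (real DIM('k) / (2 * pi)) ^ DIM('k) * rc_re (det \<Sigma>) powr (- real DIM('k) / 2) *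
     exp (- (real DIM('k) / 2) * (y \<bullet> (matrix_inv \<Sigma> *v y)))))"

definition outer_self :: "'k::real_or_complex^2 \<Rightarrow> 'k^2^2" where
  "outer_self y = (\<chi> i j. y $ i * rc_cnj (y $ j))"

text \<open>The sum is positive definite almost surely when \<open>n \<ge> 2\<close>; its law is regarded as a measure
  on \<^const>\<open>pos_def\<close>.\<close>

definition wishart :: "'k::real_or_complex^2^2 \<Rightarrow> nat \<Rightarrow> ('k^2^2) measure" where
  "wishart \<Sigma> n = restrict_space
     (distr (\<Pi>\<^sub>M i\<in>{1..n}. gaussian \<Sigma>) borel (\<lambda>Y. \<Sum>i=1..n. outer_self (Y i))) pos_def"

definition proj_wishart :: "'k::real_or_complex^2^2 \<Rightarrow> nat \<Rightarrow> ('k^2^2) measure" where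
  "proj_wishart \<Sigma> n = distr (wishart \<Sigma> n) (restrict_space borel pos_def_det1) proj_det1"

definition mat_pow :: "'k::real_or_complex^2^2 \<Rightarrow> nat \<Rightarrow> 'k^2^2" where
  "mat_pow A m = (((**) A) ^^ m) (mat 1)"

definition mat_exp :: "'k::real_or_complex^2^2 \<Rightarrow> 'k^2^2" where
  "mat_exp A = (\<Sum>m. mat_pow A m /\<^sub>R fact m)"

text \<open>On \<^const>\<open>pos_def\<close>, the two descriptions below determine a unique matrix.\<close>

definition mat_log :: "'k::real_or_complex^2^2 \<Rightarrow> 'k^2^2" where
  "mat_log X = (THE L. hermitian L \<and> mat_exp L = X)"

definition mat_sqrt :: "'k::real_or_complex^2^2 \<Rightarrow> 'k^2^2" where
  "mat_sqrt X = (THE R. R \<in> pos_def \<and> R ** R = X)"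

text \<open>The library norm on \<open>'k^2^2\<close> is the Frobenius norm.\<close>

definition ai_dist :: "real \<Rightarrow> 'k::real_or_complex^2^2 \<Rightarrow> 'k^2^2 \<Rightarrow> real" where
  "ai_dist c x y =
     c * norm (mat_log (matrix_inv (mat_sqrt x) ** y ** matrix_inv (mat_sqrt x)))"

text \<open>A nonzero Borel measure on \<^const>\<open>pos_def_det1\<close>, finite on compact sets and invariant under
  \<open>x \<mapsto> G x G\<^sup>*\<close> for every \<open>G\<close> of determinant \<open>1\<close>.  It is unique up to a positive factor.\<close>

definition invariant_volume :: "('k::real_or_complex^2^2) measure \<Rightarrow> bool" where
  "invariant_volume \<nu> \<longleftrightarrow>
     sets \<nu> = sets (restrict_space borel pos_def_det1) \<and>
     emeasure \<nu> pos_def_det1 \<noteq> 0 \<and>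
     (\<forall>C. compact C \<and> C \<subseteq> pos_def_det1 \<longrightarrow> emeasure \<nu> C < \<infinity>) \<and>
     (\<forall>G. det G = 1 \<longrightarrow> distr \<nu> \<nu> (\<lambda>x. G ** x ** adj G) = \<nu>)"

text \<open>Only the values of \<open>f\<close> on \<^const>\<open>pos_def_det1\<close> matter.\<close>

definition pw_density ::
    "('k::real_or_complex^2^2) measure \<Rightarrow> 'k^2^2 \<Rightarrow> nat \<Rightarrow> ('k^2^2 \<Rightarrow> real) \<Rightarrow> bool" where
  "pw_density \<nu> \<Sigma> n f \<longleftrightarrow>
     continuous_on pos_def_det1 f \<and> (\<forall>x\<in>pos_def_det1. f x \<ge> 0) \<and>
     proj_wishart \<Sigma> n = density \<nu> (\<lambda>x. ennreal (f x))"

end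

theory Submission
  imports Defs
begin

text \<open>
  Write a frame \<open>Y = (Y\<^sub>1, \<dots>, Y\<^sub>n)\<close> of vectors with Gram matrix \<open>X = \<Sum> Y\<^sub>i Y\<^sub>i\<^sup>* = \<delta> x\<close>, where
  \<open>\<delta> = det(X)\<^sup>1\<^sup>/\<^sup>2\<close> and \<open>det x = 1\<close>.  The Gaussian density of \<open>Y\<close> is proportional to
  \<open>exp (- \<kappa> \<delta> h(x))\<close> with \<open>h(x) = tr(\<Sigma>'\<^sup>-\<^sup>1 x) / 2\<close> for the normalization \<open>\<Sigma>'\<close> of \<open>\<Sigma>\<close>.  Lebesgue
  measure on frames is invariant under \<open>SL\<^sub>2\<close> and homogeneous of degree \<open>p = kn\<close> in \<open>\<delta>\<close>, so in the
  coordinates \<open>(x, \<delta>)\<close> it is the product of an invariant volume and of \<open>\<delta>\<^sup>p\<^sup>-\<^sup>1 d\<delta>\<close>; integrating out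
  \<open>\<delta>\<close> leaves \<open>h(x)\<^sup>-\<^sup>p\<close>.  The eigenvalues of \<open>\<Sigma>'\<^sup>-\<^sup>1 x\<close> are \<open>e\<^sup>r\<close> and \<open>e\<^sup>-\<^sup>r\<close>, whose logarithms have
  Euclidean norm \<open>sqrt 2 r\<close>, so \<open>h(x) = cosh r\<close> is the hyperbolic cosine of the distance normalized by
  \<open>c = 1 / sqrt 2\<close>.

  The invariant volume is unique because \<open>SL\<^sub>2\<close> acts transitively: an invariant measure gives the same
  mass to all balls of a given radius, and two such measures are proportional.  The balls are those of
  the kernel obtained by polarizing the determinant.  The same uniqueness, for Lebesgue measure,
  yields the invariance on frames.
\<close>

subsection \<open>Uniformly distributed measures\<close>

text \<open>Only its symmetries describe \<open>\<nu>\<close>, so there is no formula to compute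
  with on \<open>pos_def_det1\<close>. A second uniform measure, \<open>shape_volume n\<close>, is
  therefore built from Lebesgue measure on frames; as it is proportional to \<open>\<nu>\<close>,
  integrals over \<open>pos_def_det1\<close> become integrals over frames. The product structure in
  \<open>(x, \<delta>)\<close> is not obtained from a Jacobian: an auxiliary dilation
  \<open>t\<close> is integrated in, and Fubini with the scaling of Lebesgue measure does the rest.

  Transitivity holds in a strong form: the square root of \<open>x\<close> carries the identity to
  \<open>x\<close>. Hence only Hermitian matrices of determinant 1 must be shown to preserve
  Lebesgue measure on frames, and a symmetry argument does this for both fields at once.

  The kernel \<open>rc_re (det_polar x y) - 2\<close> is \<open>2 cosh r - 2\<close>: polynomial in
  the entries and visibly invariant, whereas the distance hides behind definite descriptions. Near
  the diagonal it behaves like a squared distance and violates the triangle inequality, so the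
  locale asks only for symmetry, continuity and small balls.\<close>

locale distance_kernel =
  fixes X :: "'a::second_countable_topology set" and d :: "'a \<Rightarrow> 'a \<Rightarrow> real"
  assumes kernel_domain: "X \<in> sets borel"
    and kernel_sym: "x \<in> X \<Longrightarrow> y \<in> X \<Longrightarrow> d x y = d y x"
    and kernel_self: "x \<in> X \<Longrightarrow> d x x = 0"
    and kernel_continuous: "continuous_on (X \<times> X) (\<lambda>(x, y). d x y)"
    and kernel_nhds: "open U \<Longrightarrow> x \<in> U \<inter> X \<Longrightarrow> \<exists>r>0. \<forall>y\<in>X. d x y < r \<longrightarrow> y \<in> U"
begin

definition kball :: "'a \<Rightarrow> real \<Rightarrow> 'a set" where
  "kball x r = {y \<in> X. d x y < r}"

text \<open>Finiteness is asked at every radius, not only at small ones: the balls of integer radius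
  then exhaust \<open>X\<close> and give sigma-finiteness.\<close>

definition uniform :: "'a measure \<Rightarrow> bool" where
  "uniform M \<longleftrightarrow> sets M = sets (restrict_space borel X) \<and> emeasure M X \<noteq> 0 \<and>
     (\<forall>r. \<forall>x\<in>X. emeasure M (kball x r) < \<infinity>) \<and>
     (\<forall>r. \<forall>x\<in>X. \<forall>y\<in>X. emeasure M (kball x r) = emeasure M (kball y r))"

lemma uniformD:
  assumes "uniform M"
  shows "sets M = sets (restrict_space borel X)" "emeasure M X \<noteq> 0" "space M = X"
    "x \<in> X \<Longrightarrow> emeasure M (kball x r) < \<infinity>"
    "x \<in> X \<Longrightarrow> y \<in> X \<Longrightarrow> emeasure M (kball x r) = emeasure M (kball y r)"
proof -
  show sets: "sets M = sets (restrict_space borel X)"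
    using assms unfolding uniform_def by blast
  show "space M = X"
    using sets_eq_imp_space_eq[OF sets] by (simp add: space_restrict_space)
qed (use assms in \<open>unfold uniform_def, blast+\<close>)

lemma uniform_nonempty: "uniform M \<Longrightarrow> X \<noteq> {}"
  using uniformD(2) by force

lemma kball_open:
  assumes "x \<in> X"
  obtains U where "open U" "kball x r = X \<inter> U"
proof -
  have "continuous_on X (\<lambda>y. (x, y))"
    by (intro continuous_intros)
  then have "continuous_on X (\<lambda>y. (\<lambda>(x, y). d x y) (x, y))"
    by (rule continuous_on_compose2[OF kernel_continuous]) (use assms in auto)
  then have "openin (top_of_set X) (X \<inter> (\<lambda>y. d x y) -` {..<r})"
    by (intro continuous_openin_preimage_gen) auto
  also have "X \<inter> (\<lambda>y. d x y) -` {..<r} = kball x r"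
    by (auto simp: kball_def)
  finally show ?thesis
    using that by (auto simp: openin_open)
qed

lemma open_in_sets: "uniform M \<Longrightarrow> open U \<Longrightarrow> X \<inter> U \<in> sets M"
  by (auto simp: uniformD sets_restrict_space)

lemma kball_sets [measurable]:
  assumes "uniform M" "x \<in> X"
  shows "kball x r \<in> sets M"
  using kball_open[OF assms(2), of r] open_in_sets[OF assms(1)] by metis

text \<open>If one ball of radius \<open>r\<close> is null, all of them are; by Lindelof countably
  many cover \<open>X\<close>, which would then be null.\<close>

lemma uniform_kball_pos:
  assumes M: "uniform M" and "r > 0" "x \<in> X"
  shows "emeasure M (kball x r) > 0"
proof (rule ccontr)
  assume "\<not> emeasure M (kball x r) > 0"
  then have null: "emeasure M (kball y r) = 0" if "y \<in> X" for y
    using uniformD(5)[OF M] that assms(3) by (metis not_gr_zero)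
  have "\<exists>V. open V \<and> kball y r = X \<inter> V" if "y \<in> X" for y
    by (rule kball_open[OF that]) blast
  then obtain U where U: "\<And>y. y \<in> X \<Longrightarrow> open (U y) \<and> kball y r = X \<inter> U y"
    by metis
  obtain F where F: "F \<subseteq> U ` X" "countable F" "\<Union>F = \<Union>(U ` X)"
    using Lindelof[of "U ` X"] U by auto
  have "X \<inter> V \<in> null_sets M" if "V \<in> F" for V
    using that F(1) U null open_in_sets[OF M] by (auto simp: null_sets_def)
  then have "(\<Union>V\<in>F. X \<inter> V) \<in> null_sets M"
    using F(2) by (intro null_sets_UN') auto
  also have "(\<Union>V\<in>F. X \<inter> V) = X \<inter> \<Union>F"
    by auto
  also have "\<dots> = X"
  proof -
    have "y \<in> U y" if "y \<in> X" for y
    proof -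
      have "y \<in> kball y r"
        using kernel_self[OF that] that \<open>r > 0\<close> by (simp add: kball_def)
      then show ?thesis
        using U[OF that] by blast
    qed
    then show ?thesis
      unfolding F(3) by blast
  qed
  finally show False
    using uniformD(2)[OF M] by (simp add: null_sets_def)
qed

lemma UN_kball: "(\<Union>n. kball x (real n)) = X"
  by (auto simp: kball_def intro: reals_Archimedean2)

lemma uniform_sigma_finite:
  assumes M: "uniform M"
  shows "sigma_finite_measure M"
proof -
  obtain x where x: "x \<in> X"
    using uniform_nonempty[OF M] by auto
  show ?thesis
  proof
    show "\<exists>F. countable F \<and> F \<subseteq> sets M \<and> \<Union>F = space M \<and> (\<forall>a\<in>F. emeasure M a \<noteq> \<infinity>)"
      using uniformD(4)[OF M x] kball_sets[OF M x] UN_kball[of x] uniformD(3)[OF M]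
      by (intro exI[of _ "range (\<lambda>n::nat. kball x (real n))"]) (auto simp: less_top[symmetric])
  qed
qed

text \<open>Continuity is known on \<open>X \<times> X\<close> only. Second countability identifies
  the Borel sets of the product with the product of the Borel sets.\<close>

lemma kernel_measurable:
  assumes M: "uniform M" and N: "uniform N"
  shows "(\<lambda>(x, y). d x y) \<in> borel_measurable (M \<Otimes>\<^sub>M N)"
proof -
  have "(\<lambda>(x, y). d x y) \<in> borel_measurable (restrict_space borel (X \<times> X))"
    by (intro borel_measurable_continuous_on_restrict kernel_continuous)
  moreover have "(\<lambda>z. z) \<in> measurable (M \<Otimes>\<^sub>M N) (restrict_space borel (X \<times> X))"
  proof (rule measurable_restrict_space2)
    show "(\<lambda>z. z) \<in> measurable (M \<Otimes>\<^sub>M N) borel"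
    proof -
      have "fst \<in> measurable (M \<Otimes>\<^sub>M N) borel" "snd \<in> measurable (M \<Otimes>\<^sub>M N) borel"
        using measurable_compose[OF measurable_fst measurable_ident_sets[OF uniformD(1)[OF M]]]
          measurable_compose[OF measurable_snd measurable_ident_sets[OF uniformD(1)[OF N]]]
          measurable_restrict_space1[OF measurable_ident]
        by (auto dest!: measurable_restrict_space2_iff[THEN iffD1])
      then have "(\<lambda>z. (fst z, snd z)) \<in> measurable (M \<Otimes>\<^sub>M N) (borel \<Otimes>\<^sub>M borel)"
        by (intro measurable_Pair)
      then show ?thesis
        by (simp add: borel_prod)
    qed
  qed (auto simp: space_pair_measure uniformD[OF M] uniformD[OF N])
  ultimately show ?thesis
    using measurable_compose[of "\<lambda>z. z"] by auto
qed

text \<open>Averaging over shrinking balls recovers the measure of an open set (Christensen's argument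
  for the uniqueness of uniformly distributed measures).\<close>

lemma uniform_average:
  assumes M: "uniform M" and N: "uniform N" and U: "open U" and x0: "x0 \<in> X"
    and fin: "emeasure M (X \<inter> U) < \<infinity>"
  defines "r \<equiv> \<lambda>n. 1 / real (Suc n)"
  obtains p where "p \<longlonglongrightarrow> emeasure M (X \<inter> U)"
    "\<And>n. p n * emeasure N (kball x0 (r n)) \<le> emeasure M (kball x0 (r n)) * emeasure N (X \<inter> U)"
proof -
  interpret N: sigma_finite_measure N by (rule uniform_sigma_finite[OF N])
  interpret M: sigma_finite_measure M by (rule uniform_sigma_finite[OF M])
  interpret pair_sigma_finite M N by unfold_locales
  let ?A = "X \<inter> U"
  \<comment> \<open>\<open>I n\<close> marks the pairs in \<open>?A \<times> ?A\<close> closer than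
    \<open>r n\<close>. Its double integral is evaluated in both orders: integrating over
    \<open>y\<close> first gives an approximation to the indicator of \<open>?A\<close>, integrating
    over \<open>x\<close> first gives at most \<open>a n\<close> on \<open>?A\<close>.\<close>
  define I where "I n x y = (indicator {(x, y). x \<in> ?A \<and> y \<in> ?A \<and> d x y < r n} (x, y) :: ennreal)" for n x y
  have A [measurable]: "?A \<in> sets M" "?A \<in> sets N"
    using open_in_sets M N U by auto
  have I_meas [measurable]: "case_prod (I n) \<in> borel_measurable (M \<Otimes>\<^sub>M N)" for n
  proof -
    note kernel_measurable[OF M N, measurable]
    have "{z \<in> space (M \<Otimes>\<^sub>M N). fst z \<in> ?A \<and> snd z \<in> ?A \<and> (\<lambda>(x, y). d x y) z < r n} \<in> sets (M \<Otimes>\<^sub>M N)"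
      by measurable
    also have "{z \<in> space (M \<Otimes>\<^sub>M N). fst z \<in> ?A \<and> snd z \<in> ?A \<and> (\<lambda>(x, y). d x y) z < r n}
        = {(x, y). x \<in> ?A \<and> y \<in> ?A \<and> d x y < r n}"
      by (auto simp: space_pair_measure uniformD[OF M] uniformD[OF N])
    finally have "(indicator {(x, y). x \<in> ?A \<and> y \<in> ?A \<and> d x y < r n} :: _ \<Rightarrow> ennreal)
        \<in> borel_measurable (M \<Otimes>\<^sub>M N)"
      by simp
    then show ?thesis
      by (simp add: I_def case_prod_unfold)
  qed
  define a where "a n = emeasure M (kball x0 (r n))" for n
  define b where "b n = emeasure N (kball x0 (r n))" for n
  have r: "r n > 0" for n
    by (simp add: r_def)
  have b: "b n \<noteq> 0" "b n \<noteq> \<infinity>" for n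
    using uniform_kball_pos[OF N r[of n] x0] uniformD(4)[OF N x0] by (auto simp: b_def less_top[symmetric])
  define q where "q n x = (\<integral>\<^sup>+y. I n x y \<partial>N)" for n x
  have q_meas [measurable]: "q n \<in> borel_measurable M" for n
    unfolding q_def by measurable
  have q_eq: "q n x = indicator ?A x * emeasure N (?A \<inter> kball x (r n))" if "x \<in> X" for n x
  proof -
    have "q n x = (\<integral>\<^sup>+y. indicator ?A x * indicator (?A \<inter> kball x (r n)) y \<partial>N)"
      unfolding q_def
      by (intro nn_integral_cong) (auto simp: I_def kball_def indicator_def)
    also have "\<dots> = indicator ?A x * emeasure N (?A \<inter> kball x (r n))"
      using kball_sets[OF N that] by (subst nn_integral_cmult_indicator) auto
    finally show ?thesis .
  qed
  \<comment> \<open>The integrand is the share of the \<open>N\<close>-mass of the ball around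
    \<open>x\<close> that lies in \<open>?A\<close>. It is at most 1 and eventually equals 1 at each
    point of \<open>?A\<close>, so dominated convergence applies, with \<open>fin\<close> making the
    bound integrable.\<close>
  define p where "p n = (\<integral>\<^sup>+x. q n x / b n \<partial>M)" for n
  have "p \<longlonglongrightarrow> (\<integral>\<^sup>+x. indicator ?A x \<partial>M)"
    unfolding p_def
  proof (rule nn_integral_dominated_convergence[where w = "indicator ?A"])
    show "AE x in M. q n x / b n \<le> indicator ?A x" for n
    proof (rule AE_I2)
      fix x assume "x \<in> space M"
      then have x: "x \<in> X"
        by (simp add: uniformD[OF M])
      have "emeasure N (?A \<inter> kball x (r n)) \<le> emeasure N (kball x (r n))"
        using kball_sets[OF N x] by (intro emeasure_mono) auto
      also have "\<dots> = b n"
        unfolding b_def using uniformD(5)[OF N x x0] .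
      finally show "q n x / b n \<le> indicator ?A x"
        using b[of n] by (auto simp: q_eq[OF x] indicator_def divide_le_posI_ennreal zero_less_iff_neq_zero)
    qed
    show "AE x in M. (\<lambda>n. q n x / b n) \<longlonglongrightarrow> indicator ?A x"
    proof (rule AE_I2)
      fix x assume "x \<in> space M"
      then have x: "x \<in> X"
        by (simp add: uniformD[OF M])
      show "(\<lambda>n. q n x / b n) \<longlonglongrightarrow> indicator ?A x"
      proof (cases "x \<in> U")
        case False
        then show ?thesis
          using b by (simp add: q_eq[OF x])
      next
        case True
        then obtain \<epsilon> where \<epsilon>: "\<epsilon> > 0" "\<And>y. y \<in> X \<Longrightarrow> d x y < \<epsilon> \<Longrightarrow> y \<in> U"
          using kernel_nhds[OF U, of x] x by auto
        have "\<forall>\<^sub>F n in sequentially. r n < \<epsilon>"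
          unfolding r_def using \<epsilon>(1) by real_asymp
        then have "\<forall>\<^sub>F n in sequentially. q n x / b n = indicator ?A x"
        proof eventually_elim
          case (elim n)
          then have "?A \<inter> kball x (r n) = kball x (r n)"
            using \<epsilon>(2) by (force simp: kball_def)
          moreover have "emeasure N (kball x (r n)) = b n"
            unfolding b_def using uniformD(5)[OF N x x0] .
          ultimately show ?case
            using True x b[of n] by (simp add: q_eq[OF x] ennreal_divide_self less_top)
        qed
        then show ?thesis
          by (rule tendsto_eventually)
      qed
    qed
  qed (use fin in auto)
  then have "p \<longlonglongrightarrow> emeasure M ?A"
    by simp
  moreover have "p n * b n \<le> a n * emeasure N ?A" for n
  proof -
    have "p n * b n = (\<integral>\<^sup>+x. q n x \<partial>M)"
      unfolding p_def using b[of n]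
      by (subst nn_integral_multc[symmetric])
        (auto intro!: nn_integral_cong simp: ennreal_divide_times ennreal_divide_self less_top)
    also have "\<dots> = (\<integral>\<^sup>+y. \<integral>\<^sup>+x. I n x y \<partial>M \<partial>N)"
      unfolding q_def by (rule Fubini'[symmetric]) measurable
    also have "\<dots> \<le> (\<integral>\<^sup>+y. a n * indicator ?A y \<partial>N)"
    proof (rule nn_integral_mono)
      fix y assume "y \<in> space N"
      then have y: "y \<in> X"
        by (simp add: uniformD[OF N])
      have "(\<integral>\<^sup>+x. I n x y \<partial>M) \<le> (\<integral>\<^sup>+x. indicator ?A y * indicator (kball y (r n)) x \<partial>M)"
        by (intro nn_integral_mono) (auto simp: I_def kball_def indicator_def kernel_sym y)
      also have "\<dots> = indicator ?A y * emeasure M (kball y (r n))"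
        using kball_sets[OF M y] by (simp add: nn_integral_cmult_indicator)
      also have "\<dots> = a n * indicator ?A y"
        unfolding a_def using uniformD(5)[OF M y x0] by (simp add: mult.commute)
      finally show "(\<integral>\<^sup>+x. I n x y \<partial>M) \<le> a n * indicator ?A y" .
    qed
    also have "\<dots> = a n * emeasure N ?A"
      by (simp add: nn_integral_cmult_indicator)
    finally show ?thesis .
  qed
  ultimately show thesis
    using that unfolding a_def b_def by blast
qed

text \<open>\<open>uniform_average\<close> is used twice, with \<open>M\<close> and \<open>N\<close>
  exchanged. In the product of the two inequalities the ball masses \<open>a n * b n\<close> cancel,
  so convergence of the ratio \<open>a n / b n\<close> never becomes an issue.\<close>

lemma uniform_cross_le:
  assumes M: "uniform M" and N: "uniform N" and U: "open U" and V: "open V"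
    and fin: "emeasure M (X \<inter> U) < \<infinity>" "emeasure N (X \<inter> V) < \<infinity>"
  shows "emeasure M (X \<inter> U) * emeasure N (X \<inter> V) \<le> emeasure N (X \<inter> U) * emeasure M (X \<inter> V)"
proof -
  obtain x0 where x0: "x0 \<in> X"
    using uniform_nonempty[OF M] by auto
  define a where "a n = emeasure M (kball x0 (1 / real (Suc n)))" for n
  define b where "b n = emeasure N (kball x0 (1 / real (Suc n)))" for n
  obtain p where p: "p \<longlonglongrightarrow> emeasure M (X \<inter> U)" "\<And>n. p n * b n \<le> a n * emeasure N (X \<inter> U)"
    using uniform_average[OF M N U x0 fin(1)] unfolding a_def b_def by metis
  obtain q where q: "q \<longlonglongrightarrow> emeasure N (X \<inter> V)" "\<And>n. q n * a n \<le> b n * emeasure M (X \<inter> V)"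
    using uniform_average[OF N M V x0 fin(2)] unfolding a_def b_def by metis
  have "p n * q n \<le> emeasure N (X \<inter> U) * emeasure M (X \<inter> V)" for n
  proof -
    have ab: "a n \<noteq> 0" "a n \<noteq> \<infinity>" "b n \<noteq> 0" "b n \<noteq> \<infinity>"
      using uniform_kball_pos[OF _ _ x0] uniformD(4)[OF _ x0] M N
      by (auto simp: a_def b_def less_top[symmetric] zero_less_iff_neq_zero)
    have "(a n * b n) * (p n * q n) = (p n * b n) * (q n * a n)"
      by (simp add: mult_ac)
    also have "\<dots> \<le> (a n * emeasure N (X \<inter> U)) * (b n * emeasure M (X \<inter> V))"
      by (intro mult_mono p(2) q(2)) auto
    also have "\<dots> = (a n * b n) * (emeasure N (X \<inter> U) * emeasure M (X \<inter> V))"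
      by (simp add: mult_ac)
    finally show ?thesis
      using ab ennreal_mult_le_mult_iff[of "a n * b n"] by (simp add: ennreal_mult_eq_top_iff)
  qed
  moreover have "(\<lambda>n. p n * q n) \<longlonglongrightarrow> emeasure M (X \<inter> U) * emeasure N (X \<inter> V)"
    using fin by (intro tendsto_mult_ennreal p(1) q(1)) auto
  ultimately show ?thesis
    by (intro LIMSEQ_le_const2) auto
qed

text \<open>A unit ball fixes the constant. The cross inequality, read in both directions, gives
  equality on open sets of finite mass; exhaustion by balls extends it to all open sets, whose
  traces on \<open>X\<close> form an intersection-stable generator.\<close>

theorem uniform_proportional:
  assumes M: "uniform M" and N: "uniform N"
  obtains c :: real where "c > 0" "M = density N (\<lambda>_. ennreal c)"
proof -
  obtain x where x: "x \<in> X"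
    using uniform_nonempty[OF M] by auto
  obtain V where V: "open V" "kball x 1 = X \<inter> V"
    using kball_open[OF x] by metis
  let ?m = "emeasure M (X \<inter> V)" and ?n = "emeasure N (X \<inter> V)"
  have fin: "?m \<noteq> 0" "?m \<noteq> \<infinity>" "?n \<noteq> 0" "?n \<noteq> \<infinity>"
    using uniform_kball_pos[OF _ _ x, of _ 1] uniformD(4)[OF _ x, of _ 1] M N
    by (auto simp: V(2)[symmetric] less_top[symmetric] zero_less_iff_neq_zero)
  define c where "c = enn2real (?m / ?n)"
  have c: "ennreal c = ?m / ?n" "c > 0"
    using fin by (auto simp: c_def enn2real_positive_iff less_top[symmetric] ennreal_divide_eq_top_iff
        zero_less_iff_neq_zero ennreal_divide_eq_0_iff ennreal_top_eq_mult_iff)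
  let ?N = "density N (\<lambda>_. ennreal c)"
  have fin_eq: "emeasure M (X \<inter> U) = ennreal c * emeasure N (X \<inter> U)"
    if U: "open U" and "emeasure M (X \<inter> U) < \<infinity>" "emeasure N (X \<inter> U) < \<infinity>" for U
  proof -
    have "emeasure M (X \<inter> U) * ?n = emeasure N (X \<inter> U) * ?m"
    proof (rule antisym)
      show "emeasure M (X \<inter> U) * ?n \<le> emeasure N (X \<inter> U) * ?m"
        using that fin by (intro uniform_cross_le M N V(1)) (auto simp: less_top)
      show "emeasure N (X \<inter> U) * ?m \<le> emeasure M (X \<inter> U) * ?n"
        using that fin by (intro uniform_cross_le M N V(1)) (auto simp: less_top)
    qed
    then have "emeasure M (X \<inter> U) * ?n / ?n = emeasure N (X \<inter> U) * ?m / ?n"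
      by simp
    moreover have "emeasure M (X \<inter> U) * ?n / ?n = emeasure M (X \<inter> U)"
      using fin by (intro ennreal_mult_divide_eq) auto
    ultimately show ?thesis
      by (simp add: c(1) ennreal_times_divide mult.commute)
  qed
  have W: "\<exists>W. open W \<and> kball x (real n) = X \<inter> W" for n
    using kball_open[OF x] by metis
  then obtain W where W: "\<And>n::nat. open (W n)" "\<And>n. kball x (real n) = X \<inter> W n"
    by metis
  have open_eq: "emeasure M (X \<inter> U) = emeasure ?N (X \<inter> U)" if U: "open U" for U
  proof -
    have *: "emeasure L (X \<inter> U) = (SUP n. emeasure L (X \<inter> (U \<inter> W n)))" if L: "uniform L" for L
    proof -
      have "(SUP n. emeasure L (X \<inter> (U \<inter> W n))) = emeasure L (\<Union>n. X \<inter> (U \<inter> W n))"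
      proof (rule SUP_emeasure_incseq)
        have "kball x (real m) \<subseteq> kball x (real n)" if "m \<le> n" for m n
          using that by (auto simp: kball_def)
        then show "incseq (\<lambda>n. X \<inter> (U \<inter> W n))"
          using W(2) by (fastforce simp: incseq_def)
        show "range (\<lambda>n. X \<inter> (U \<inter> W n)) \<subseteq> sets L"
          using open_in_sets[OF L open_Int[OF U W(1)]] by blast
      qed
      also have "(\<Union>n. X \<inter> (U \<inter> W n)) = X \<inter> U"
        using UN_kball[of x] W(2) by auto
      finally show ?thesis by simp
    qed
    have "emeasure L (X \<inter> (U \<inter> W n)) < \<infinity>" if L: "uniform L" for L n
    proof -
      have "emeasure L (X \<inter> (U \<inter> W n)) \<le> emeasure L (kball x (real n))"
        by (rule emeasure_mono[OF _ kball_sets[OF L x]]) (auto simp: W(2))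
      then show ?thesis
        using uniformD(4)[OF L x, of "real n"] by (auto simp: less_top[symmetric] top_unique)
    qed
    then have "emeasure M (X \<inter> U) = (SUP n. ennreal c * emeasure N (X \<inter> (U \<inter> W n)))"
      using fin_eq[of "U \<inter> W _"] U W(1) M N by (subst *[OF M]) (simp add: open_Int)
    also have "\<dots> = ennreal c * emeasure N (X \<inter> U)"
      by (simp add: *[OF N] SUP_mult_left_ennreal)
    also have "\<dots> = emeasure ?N (X \<inter> U)"
      using open_in_sets[OF N U] by (simp add: emeasure_density_const)
    finally show ?thesis .
  qed
  have gen: "sets L = sigma_sets X ((\<inter>) X ` {U. open U})" if "uniform L" for L
    using sigma_sets_Int[of X UNIV "{U. open U}"] kernel_domain
    by (simp add: uniformD(1)[OF that] sets_restrict_space borel_def Collect_mem_eq)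
  have "M = ?N"
  proof (rule measure_eqI_generator_eq[where \<Omega> = X and E = "(\<inter>) X ` {U. open U}"
        and A = "\<lambda>n. kball x (real n)"])
    show "Int_stable ((\<inter>) X ` {U. open U})"
    proof (rule Int_stableI)
      fix a b assume "a \<in> (\<inter>) X ` {U. open U}" "b \<in> (\<inter>) X ` {U. open U}"
      then obtain U V where "open U" "open V" "a = X \<inter> U" "b = X \<inter> V"
        by auto
      then show "a \<inter> b \<in> (\<inter>) X ` {U. open U}"
        by (intro image_eqI[of _ _ "U \<inter> V"]) auto
    qed
    show "emeasure M (kball x (real i)) \<noteq> \<infinity>" for i
      using uniformD(4)[OF M x, of "real i"] by auto
    show "(\<Union>i. kball x (real i)) = X"
      by (rule UN_kball)
  qed (use open_eq gen[OF M] gen[OF N] W in auto)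
  then show thesis
    using that c(2) by blast
qed

end

subsection \<open>Conjugation\<close>

lemma rc_cnj_0 [simp]: "rc_cnj (0 :: 'k::real_or_complex) = 0"
  using rc_cnj_add[of "0::'k" 0] by simp

lemma rc_cnj_of_real [simp]: "rc_cnj (of_real r :: 'k::real_or_complex) = of_real r"
proof (cases "r = 0")
  case False
  have "(of_real r :: 'k) * rc_cnj (of_real r) = of_real r * of_real r"
    by (simp add: rc_mult_cnj scaleR_conv_of_real power2_eq_square flip: of_real_mult)
  with False show ?thesis
    by simp
qed auto

lemma rc_cnj_1 [simp]: "rc_cnj (1 :: 'k::real_or_complex) = 1"
  using rc_cnj_of_real[of 1] by simp

lemma rc_cnj_minus [simp]: "rc_cnj (- x :: 'k::real_or_complex) = - rc_cnj x"
  using rc_cnj_add[of x "- x"] by (simp add: eq_neg_iff_add_eq_0 add.commute)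

lemma rc_cnj_diff: "rc_cnj (x - y :: 'k::real_or_complex) = rc_cnj x - rc_cnj y"
  using rc_cnj_add[of x "- y"] by simp

lemma rc_cnj_scaleR: "rc_cnj (r *\<^sub>R x :: 'k::real_or_complex) = r *\<^sub>R rc_cnj x"
  by (simp add: scaleR_conv_of_real rc_cnj_mult)

lemma rc_cnj_sum: "rc_cnj (\<Sum>i\<in>I. f i :: 'k::real_or_complex) = (\<Sum>i\<in>I. rc_cnj (f i))"
  by (induction I rule: infinite_finite_induct) (auto simp: rc_cnj_add)

lemma norm_rc_cnj [simp]: "norm (rc_cnj x :: 'k::real_or_complex) = norm x"
proof -
  have "((norm x)\<^sup>2 *\<^sub>R 1 :: 'k) = (norm (rc_cnj x))\<^sup>2 *\<^sub>R 1"
    using rc_mult_cnj[of x] rc_mult_cnj[of "rc_cnj x"] by (simp add: rc_cnj_cnj mult.commute)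
  then show ?thesis
    by simp
qed

lemma rc_mult_cnj_of_real: "x * rc_cnj x = (of_real ((norm x)\<^sup>2) :: 'k::real_or_complex)"
  by (simp add: rc_mult_cnj scaleR_conv_of_real)

lemma rc_cnj_mult_of_real: "rc_cnj x * x = (of_real ((norm x)\<^sup>2) :: 'k::real_or_complex)"
  using rc_mult_cnj_of_real[of x] by (simp add: mult.commute)

lemma rc_re_inner: "rc_re (x :: 'k::real_or_complex) = 1 \<bullet> x"
  by (simp add: rc_inner_eq)

lemma rc_re_add [simp]: "rc_re (x + y :: 'k::real_or_complex) = rc_re x + rc_re y"
  and rc_re_diff [simp]: "rc_re (x - y :: 'k::real_or_complex) = rc_re x - rc_re y"
  and rc_re_minus [simp]: "rc_re (- x :: 'k::real_or_complex) = - rc_re x"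
  and rc_re_scaleR [simp]: "rc_re (r *\<^sub>R x :: 'k::real_or_complex) = r * rc_re x"
  and rc_re_0 [simp]: "rc_re (0 :: 'k::real_or_complex) = 0"
  and rc_re_1 [simp]: "rc_re (1 :: 'k::real_or_complex) = 1"
  by (simp_all add: rc_re_inner inner_add_right inner_diff_right norm_eq_1[symmetric])

lemma rc_re_sum: "rc_re (\<Sum>i\<in>I. f i :: 'k::real_or_complex) = (\<Sum>i\<in>I. rc_re (f i))"
  by (simp add: rc_re_inner inner_sum_right)

lemma rc_re_of_real [simp]: "rc_re (of_real r :: 'k::real_or_complex) = r"
  using rc_re_scaleR[of r "1::'k"] by (simp add: scaleR_conv_of_real)

lemma rc_re_numeral [simp]: "rc_re (numeral n :: 'k::real_or_complex) = numeral n"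
  using rc_re_of_real[of "numeral n"] by simp

lemma rc_re_of_real_mult [simp]: "rc_re (of_real r * x :: 'k::real_or_complex) = r * rc_re x"
  using rc_re_scaleR[of r x] by (simp add: scaleR_conv_of_real)

lemma rc_real_of_cnj_eq:
  assumes "rc_cnj x = (x :: 'k::real_or_complex)"
  shows "x = of_real (rc_re x)"
proof -
  have "2 * x = 2 * of_real (rc_re x)"
    using rc_add_cnj[of x] assms by (simp add: scaleR_conv_of_real)
  then show ?thesis
    by simp
qed

lemma bounded_linear_rc_cnj: "bounded_linear (rc_cnj :: 'k::real_or_complex \<Rightarrow> 'k)"
  by (rule bounded_linear_intro[where K = 1]) (auto simp: rc_cnj_add rc_cnj_scaleR)

lemma bounded_linear_rc_re: "bounded_linear (rc_re :: 'k::real_or_complex \<Rightarrow> real)"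
  unfolding rc_re_inner[abs_def] by (rule bounded_linear_inner_right)

lemmas continuous_on_rc_cnj [continuous_intros] = bounded_linear.continuous_on[OF bounded_linear_rc_cnj]
lemmas continuous_on_rc_re [continuous_intros] = bounded_linear.continuous_on[OF bounded_linear_rc_re]

lemma inner_mult_right_cnj: "x \<bullet> (c * y) = (rc_cnj c * x) \<bullet> (y :: 'k::real_or_complex)"
  by (simp add: rc_inner_eq rc_cnj_mult rc_cnj_cnj mult_ac)

subsection \<open>Hermitian two by two matrices\<close>

lemma adj_nth [simp]: "adj A $ i $ j = rc_cnj (A $ j $ i)"
  by (simp add: adj_def)

lemma adj_adj [simp]: "adj (adj A) = A"
  by (simp add: vec_eq_iff rc_cnj_cnj)

lemma adj_mat_1: "adj (mat 1) = mat 1"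
  by (simp add: vec_eq_iff mat_def)

lemma adj_mult: "adj (A ** B) = adj B ** adj A"
  by (simp add: vec_eq_iff matrix_matrix_mult_def rc_cnj_sum rc_cnj_mult mult.commute)

lemma det_adj: "det (adj A) = rc_cnj (det A)"
  by (simp add: det_2 rc_cnj_diff rc_cnj_mult mult.commute)

lemma inner_adj: "v \<bullet> (A *v w) = (adj A *v v) \<bullet> (w :: 'k::real_or_complex^2)"
  by (simp add: inner_vec_def sum_2 matrix_vector_mult_def inner_add_right inner_add_left
      inner_mult_right_cnj)

lemma matrix_scaleR_left: "(r *\<^sub>R A) ** B = r *\<^sub>R (A ** (B :: 'k::real_normed_field^2^2))"
  and matrix_scaleR_right: "A ** (r *\<^sub>R B) = r *\<^sub>R (A ** (B :: 'k::real_normed_field^2^2))"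
  by (simp_all add: vec_eq_iff matrix_matrix_mult_def sum_2 scaleR_add_right)

lemma matrix_scaleR_nth: "(r *\<^sub>R A) $ i $ j = of_real r * (A :: 'k::real_normed_field^2^2) $ i $ j"
  by (simp add: scaleR_conv_of_real[of r "A $ i $ j"])

lemma det_scaleR: "det (r *\<^sub>R A) = r\<^sup>2 *\<^sub>R det (A :: 'k::real_normed_field^2^2)"
  by (simp add: det_2 scaleR_diff_right power2_eq_square)

lemma adj_scaleR: "adj (r *\<^sub>R A) = r *\<^sub>R adj A"
  by (simp add: vec_eq_iff rc_cnj_scaleR)

text \<open>Being polynomial in the entries, it stands in for the inverse: on determinant 1
  directly, and after division by the determinant in the Gaussian exponent.\<close>

definition adjugate :: "'a::comm_ring_1^2^2 \<Rightarrow> 'a^2^2" where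
  "adjugate A = (\<chi> i j. if i = j then (if i = 1 then A$2$2 else A$1$1) else - A$i$j)"

lemma adjugate_mult: "A ** adjugate A = mat (det A)" "adjugate A ** A = mat (det A)"
  by (simp_all add: vec_eq_iff forall_2 matrix_matrix_mult_def sum_2 adjugate_def det_2 mat_def
      algebra_simps)

lemma det_adjugate [simp]: "det (adjugate A) = det A"
  by (simp add: det_2 adjugate_def)

lemma matrix_inv_eq:
  assumes "A ** B = mat 1" "B ** A = mat 1"
  shows "matrix_inv A = (B :: 'a::semiring_1^'n^'n)"
proof -
  have "A ** matrix_inv A = mat 1 \<and> matrix_inv A ** A = mat 1"
    unfolding matrix_inv_def by (rule someI[of _ B]) (use assms in auto)
  then show ?thesis
    using assms by (metis matrix_mul_assoc matrix_mul_lid matrix_mul_rid)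
qed

lemma matrix_inv_det1: "det A = 1 \<Longrightarrow> matrix_inv A = adjugate (A :: 'a::comm_ring_1^2^2)"
  using adjugate_mult[of A] by (intro matrix_inv_eq) auto

text \<open>The symmetric bilinear form that polarizes the determinant.\<close>

definition det_polar :: "'a::comm_ring_1^2^2 \<Rightarrow> 'a^2^2 \<Rightarrow> 'a" where
  "det_polar A B = A$1$1 * B$2$2 + A$2$2 * B$1$1 - A$1$2 * B$2$1 - A$2$1 * B$1$2"

lemma det_polar_commute: "det_polar A B = det_polar B A"
  by (simp add: det_polar_def algebra_simps)

lemma det_polar_self: "det_polar A A = 2 * det A"
  by (simp add: det_polar_def det_2 algebra_simps)

text \<open>The polarized form of the multiplicativity of \<open>det\<close>; it makes the kernel
  invariant under congruence by matrices of determinant 1.\<close>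

lemma det_polar_mult: "det_polar (G ** A ** H) (G ** B ** H) = det G * det H * det_polar A B"
  by (simp add: det_polar_def det_2 matrix_matrix_mult_def sum_2 algebra_simps)

lemma det_polar_id: "det_polar (mat 1) A = A$1$1 + A$2$2"
  by (simp add: det_polar_def mat_def)

lemma det_polar_scaleR:
  "det_polar (r *\<^sub>R A) B = r *\<^sub>R det_polar A (B :: 'k::real_normed_field^2^2)"
  "det_polar A (r *\<^sub>R B) = r *\<^sub>R det_polar A (B :: 'k::real_normed_field^2^2)"
  by (simp_all add: det_polar_def scaleR_add_right scaleR_diff_right)

text \<open>Coordinates on Hermitian matrices that serve both fields: determinant, norm and
  positivity depend only on the reals \<open>p\<close>, \<open>s\<close> and
  \<open>norm b\<close>.\<close>

definition herm_mat :: "real \<Rightarrow> 'k \<Rightarrow> real \<Rightarrow> 'k::real_or_complex^2^2" where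
  "herm_mat p b s =
     (\<chi> i j. if i = 1 then if j = 1 then of_real p else b else if j = 1 then rc_cnj b else of_real s)"

lemma herm_mat_nth [simp]:
  "herm_mat p b s $ 1 $ 1 = of_real p" "herm_mat p b s $ 1 $ 2 = b"
  "herm_mat p b s $ 2 $ 1 = rc_cnj b" "herm_mat p b s $ 2 $ 2 = of_real s"
  by (simp_all add: herm_mat_def)

lemma hermitian_iff: "hermitian A \<longleftrightarrow> (\<exists>p b s. A = herm_mat p b s)"
proof
  assume "hermitian A"
  then have *: "rc_cnj (A$1$1) = A$1$1" "rc_cnj (A$1$2) = A$2$1" "rc_cnj (A$2$2) = A$2$2"
    unfolding hermitian_def by (metis adj_nth)+
  then have "A = herm_mat (rc_re (A$1$1)) (A$1$2) (rc_re (A$2$2))"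
    by (auto simp: vec_eq_iff forall_2 intro: rc_real_of_cnj_eq)
  then show "\<exists>p b s. A = herm_mat p b s"
    by blast
qed (auto simp: hermitian_def vec_eq_iff forall_2 rc_cnj_cnj)

lemma det_herm_mat: "det (herm_mat p b s) = of_real (p * s - (norm b)\<^sup>2)"
  using rc_mult_cnj_of_real[of b] by (simp add: det_2)

lemma hermitian_det_real: "hermitian A \<Longrightarrow> det A = of_real (rc_re (det A))"
  by (auto simp: hermitian_iff det_herm_mat simp del: of_real_diff of_real_mult of_real_power)

text \<open>Completing the square in \<open>y $ 1\<close>. The factor \<open>p\<close> on the left
  clears the denominator.\<close>

lemma herm_mat_form:
  fixes y :: "'k::real_or_complex^2"
  shows "p * (y \<bullet> (herm_mat p b s *v y)) =
    (norm (p *\<^sub>R (y$1) + b * y$2))\<^sup>2 + (p * s - (norm b)\<^sup>2) * (norm (y$2))\<^sup>2"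
proof -
  have "y \<bullet> (herm_mat p b s *v y) =
      p * (y$1 \<bullet> y$1) + 2 * (y$1 \<bullet> (b * y$2)) + s * (y$2 \<bullet> y$2)"
    by (simp add: inner_vec_def sum_2 matrix_vector_mult_def inner_add_right
        inner_mult_right_cnj[of "y$2" "rc_cnj b"] rc_cnj_cnj inner_commute[of "b * y$2"]
        flip: scaleR_conv_of_real)
  moreover have "(norm (p *\<^sub>R (y$1) + b * y$2))\<^sup>2
      = p\<^sup>2 * (y$1 \<bullet> y$1) + 2 * p * (y$1 \<bullet> (b * y$2)) + (norm b)\<^sup>2 * (norm (y$2))\<^sup>2"
  proof -
    have "(b * y$2) \<bullet> (b * y$2) = (norm b)\<^sup>2 * (norm (y$2))\<^sup>2"
      by (simp add: norm_mult power_mult_distrib flip: power2_norm_eq_inner)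
    then show ?thesis
      unfolding power2_norm_eq_inner[of "p *\<^sub>R (y$1) + b * y$2"]
      by (simp add: inner_add_left inner_add_right inner_commute[of "b * y$2" "y$1"] power2_eq_square[of p]
        algebra_simps)
  qed
  ultimately show ?thesis
    by (simp add: power2_norm_eq_inner power2_eq_square[of p] algebra_simps)
qed

text \<open>Sylvester's criterion in size two, read off from \<open>herm_mat_form\<close>.\<close>

lemma pos_def_herm_mat:
  "(herm_mat p b s :: 'k::real_or_complex^2^2) \<in> pos_def \<longleftrightarrow> p > 0 \<and> p * s - (norm b)\<^sup>2 > 0"
proof
  assume "(herm_mat p b s :: 'k^2^2) \<in> pos_def"
  then have *: "y \<noteq> 0 \<Longrightarrow> y \<bullet> (herm_mat p b s *v y) > 0" for y :: "'k^2"
    by (auto simp: pos_def_def)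
  let ?e = "vector [1, 0] :: 'k^2"
  have "?e \<noteq> 0"
    by (simp add: vec_eq_iff forall_2)
  then have p: "p > 0"
    using *[of ?e] by (simp add: inner_vec_def sum_2 matrix_vector_mult_def inner_commute
        flip: rc_re_inner)
  \<comment> \<open>This vector makes the completed square vanish, so that only the determinant term
    of \<open>herm_mat_form\<close> survives.\<close>
  let ?y = "vector [- b, of_real p] :: 'k^2"
  have "?y \<noteq> 0"
    using p by (simp add: vec_eq_iff forall_2)
  then have "0 < p * (?y \<bullet> (herm_mat p b s *v ?y))"
    using *[of ?y] p by simp
  also have "\<dots> = (p * s - (norm b)\<^sup>2) * p\<^sup>2"
    unfolding herm_mat_form by (simp add: scaleR_conv_of_real)
  finally show "p > 0 \<and> p * s - (norm b)\<^sup>2 > 0"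
    using p by (simp add: zero_less_mult_iff)
next
  assume *: "p > 0 \<and> p * s - (norm b)\<^sup>2 > 0"
  have "y \<bullet> (herm_mat p b s *v y) > 0" if "y \<noteq> 0" for y :: "'k^2"
  proof -
    have "(norm (p *\<^sub>R (y$1) + b * y$2))\<^sup>2 + (p * s - (norm b)\<^sup>2) * (norm (y$2))\<^sup>2 > 0"
    proof (cases "y$2 = 0")
      case True
      then have "y$1 \<noteq> 0"
        using that by (auto simp: vec_eq_iff forall_2)
      then show ?thesis
        using True * by simp
    next
      case False
      then show ?thesis
        using * by (intro add_nonneg_pos) auto
    qed
    then have "p * (y \<bullet> (herm_mat p b s *v y)) > 0"
      by (simp add: herm_mat_form)
    with * show ?thesis
      by (simp add: zero_less_mult_iff)
  qed
  then show "(herm_mat p b s :: 'k^2^2) \<in> pos_def"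
    by (auto simp: pos_def_def hermitian_iff)
qed

lemma pos_def_iff: "A \<in> pos_def \<longleftrightarrow> hermitian A \<and> rc_re (A$1$1) > 0 \<and> rc_re (det A) > 0"
proof (cases "hermitian A")
  case True
  then obtain p b s where "A = herm_mat p b s"
    by (auto simp: hermitian_iff)
  then show ?thesis
    using True pos_def_herm_mat[of p b s] by (simp add: det_herm_mat del: of_real_diff of_real_mult of_real_power)
qed (auto simp: pos_def_def)

lemma pos_def_hermitian: "A \<in> pos_def \<Longrightarrow> hermitian A"
  and pos_def_det_pos: "A \<in> pos_def \<Longrightarrow> rc_re (det A) > 0"
  by (auto simp: pos_def_iff)

lemma pos_def_trace_pos:
  assumes "A \<in> pos_def" shows "rc_re (A$1$1 + A$2$2) > 0"
proof -
  obtain p b s where A: "A = herm_mat p b s"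
    using pos_def_hermitian[OF assms] by (auto simp: hermitian_iff)
  have *: "p > 0" "p * s > (norm b)\<^sup>2"
    using assms unfolding A pos_def_herm_mat by auto
  then have "p * s > 0"
    using zero_le_power2[of "norm b"] by linarith
  with * show ?thesis
    by (simp add: A zero_less_mult_iff)
qed

lemma pos_def_scaleR:
  assumes "A \<in> pos_def" "r > 0"
  shows "r *\<^sub>R A \<in> pos_def"
  using assms by (auto simp: pos_def_iff hermitian_def adj_scaleR det_scaleR)

lemma hermitian_congruence: "hermitian A \<Longrightarrow> hermitian (G ** A ** adj G)"
  by (simp add: hermitian_def adj_mult matrix_mul_assoc)

lemma pos_def_congruence:
  fixes G :: "'k::real_or_complex^2^2"
  assumes A: "A \<in> pos_def" and G: "det G \<noteq> 0"
  shows "G ** A ** adj G \<in> pos_def"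
proof -
  have "y \<bullet> ((G ** A ** adj G) *v y) > 0" if "y \<noteq> 0" for y
  proof -
    have "adjugate (adj G) *v (adj G *v y) = mat (rc_cnj (det G)) *v y"
      by (simp add: matrix_vector_mul_assoc adjugate_mult det_adj)
    moreover have "mat (rc_cnj (det G)) *v y \<noteq> 0"
      using that G norm_rc_cnj[of "det G"]
      by (auto simp: vec_eq_iff forall_2 matrix_vector_mult_def sum_2 mat_def simp del: norm_rc_cnj)
    ultimately have "adj G *v y \<noteq> 0"
      by auto
    then have "(adj G *v y) \<bullet> (A *v (adj G *v y)) > 0"
      using A by (auto simp: pos_def_def)
    then show ?thesis
      using inner_adj[of y G "A *v (adj G *v y)"] by (simp add: matrix_vector_mul_assoc matrix_mul_assoc)
  qed
  then show ?thesis
    using pos_def_hermitian[OF A] by (auto simp: pos_def_def hermitian_congruence)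
qed

section \<open>Determinant one: congruence, projection and square root\<close>

lemma det1_hermitian: "A \<in> pos_def_det1 \<Longrightarrow> hermitian A"
  by (auto simp: pos_def_det1_def pos_def_hermitian)

lemma det1_congruence:
  assumes "A \<in> pos_def_det1" "det G = 1"
  shows "G ** A ** adj G \<in> pos_def_det1"
  using assms pos_def_congruence[of A G] by (auto simp: pos_def_det1_def det_mul det_adj)

lemma mat_1_det1: "(mat 1 :: 'k::real_or_complex^2^2) \<in> pos_def_det1"
proof -
  have "(mat 1 :: 'k^2^2) = herm_mat 1 0 1"
    by (simp add: vec_eq_iff forall_2 mat_def)
  then show ?thesis
    using pos_def_herm_mat[of 1 "0 :: 'k" 1] by (simp add: pos_def_det1_def det_2)
qed

lemma proj_det1_mem:
  assumes "A \<in> pos_def"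
  shows "proj_det1 A \<in> pos_def_det1"
proof -
  define D where "D = rc_re (det A)"
  have D: "D > 0" "det A = of_real D"
    using assms pos_def_det_pos[OF assms] hermitian_det_real[OF pos_def_hermitian[OF assms]] by (auto simp: D_def)
  have "((D powr (-1/2))\<^sup>2) * D = 1"
    using D(1) by (simp add: powr_minus powr_half_sqrt power_inverse)
  then have "of_real ((D powr (-1/2))\<^sup>2 * D) = (1::'a)"
    by simp
  then have "det (proj_det1 A) = 1"
    unfolding proj_det1_def det_scaleR D(2) by (simp add: scaleR_conv_of_real)
  moreover have "proj_det1 A \<in> pos_def"
    unfolding proj_det1_def using assms D(1) by (intro pos_def_scaleR) (auto simp: D_def)
  ultimately show ?thesis
    by (simp add: pos_def_det1_def)
qed

lemma proj_det1_congruence: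
  assumes "det G = 1"
  shows "proj_det1 (G ** A ** adj G) = G ** proj_det1 A ** adj G"
  by (simp add: proj_det1_def det_mul det_adj assms matrix_scaleR_left matrix_scaleR_right)

lemma proj_det1_scaleR:
  assumes "r > 0" "A \<in> pos_def"
  shows "proj_det1 (r *\<^sub>R A) = proj_det1 A"
proof -
  have "(r\<^sup>2 * rc_re (det A)) powr (-1/2) * r = rc_re (det A) powr (-1/2)"
    using assms pos_def_det_pos[OF assms(2)]
    by (simp add: powr_mult powr_minus powr_half_sqrt field_simps)
  then show ?thesis
    by (simp add: proj_det1_def det_scaleR)
qed

text \<open>Cayley-Hamilton, \<open>x\<^sup>2 = tr(x) x - 1\<close>, gives \<open>(x + 1)\<^sup>2 = (tr(x) + 2) x\<close>.\<close>

definition det1_sqrt :: "'k::real_or_complex^2^2 \<Rightarrow> 'k^2^2" where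
  "det1_sqrt x = (1 / sqrt (rc_re (det_polar (mat 1) x) + 2)) *\<^sub>R (x + mat 1)"

lemma cayley_hamilton_2: "A ** A = mat (A$1$1 + A$2$2) ** A - mat (det (A :: 'a::comm_ring_1^2^2))"
  by (simp add: vec_eq_iff forall_2 matrix_matrix_mult_def sum_2 mat_def det_2 algebra_simps)

lemma det1_sqrt:
  assumes x: "x \<in> pos_def_det1"
  shows "det1_sqrt x \<in> pos_def_det1" "det1_sqrt x ** det1_sqrt x = x"
proof -
  obtain p b s where h: "x = herm_mat p b s"
    using det1_hermitian[OF x] by (auto simp: hermitian_iff)
  have "det x = 1" "p > 0"
    using x pos_def_herm_mat[of p b s] by (auto simp: h pos_def_det1_def)
  moreover from this have "p * s - (norm b)\<^sup>2 = 1"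
    unfolding h det_herm_mat by (metis of_real_eq_1_iff)
  ultimately have det: "det x = 1" "p > 0" "p * s - (norm b)\<^sup>2 = 1"
    by auto
  have tr: "rc_re (det_polar (mat 1) x) = p + s"
    by (simp add: det_polar_id h)
  have t: "p + s > 0"
    using x pos_def_trace_pos[of x] by (simp add: pos_def_det1_def h)
  have sq: "(1 / sqrt (p + s + 2))\<^sup>2 = 1 / (p + s + 2)"
    using t by (simp add: power_divide)
  have "(x + mat 1) ** (x + mat 1) = (p + s + 2) *\<^sub>R x"
    using det(1) unfolding h
    by (simp add: vec_eq_iff forall_2 matrix_matrix_mult_def sum_2 mat_def det_2 matrix_scaleR_nth
        del: vector_scaleR_component) algebra
  then show "det1_sqrt x ** det1_sqrt x = x"
    using sq t by (simp add: det1_sqrt_def tr matrix_scaleR_left matrix_scaleR_right power2_eq_square)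
  have x1: "x + mat 1 = herm_mat (p + 1) b (s + 1)"
    by (simp add: vec_eq_iff forall_2 h mat_def)
  \<comment> \<open>The determinant of \<open>x + mat 1\<close> is the trace plus 2, exactly the
    square of the denominator in \<open>det1_sqrt\<close>; hence the root again has determinant
    1.\<close>
  have d: "(p + 1) * (s + 1) - (norm b)\<^sup>2 = p + s + 2"
    using det(3) by (simp add: algebra_simps)
  have "x + mat 1 \<in> pos_def"
    unfolding x1 pos_def_herm_mat d using det(2) t by simp
  moreover have "det (det1_sqrt x) = (1 / (p + s + 2)) *\<^sub>R of_real (p + s + 2)"
    by (simp only: det1_sqrt_def tr det_scaleR sq x1 det_herm_mat d)
  then have "det (det1_sqrt x) = of_real (1 / (p + s + 2) * (p + s + 2))"
    unfolding of_real_mult by (simp only: scaleR_conv_of_real)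
  then have "det (det1_sqrt x) = 1"
    using t by simp
  ultimately show "det1_sqrt x \<in> pos_def_det1"
    using t by (auto simp: pos_def_det1_def det1_sqrt_def tr intro!: pos_def_scaleR)
qed

text \<open>Uniqueness of the root: a positive definite \<open>R\<close> with
  \<open>R ** R = x\<close> has determinant 1, so Cayley-Hamilton reads
  \<open>x + 1 = tr(R) R\<close>. Taking traces gives \<open>tr(R)^2 = tr(x) + 2\<close>, which
  determines \<open>tr(R) > 0\<close> and then \<open>R\<close>.\<close>

lemma mat_sqrt_det1:
  assumes x: "x \<in> pos_def_det1"
  shows "mat_sqrt x = det1_sqrt x"
  unfolding mat_sqrt_def
proof (rule the_equality)
  fix R assume R: "R \<in> pos_def \<and> R ** R = x"
  obtain p b s where h: "R = herm_mat p b s"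
    using pos_def_hermitian[of R] R by (auto simp: hermitian_iff)
  have "det R * det R = 1"
    using R x det_mul[of R R] by (simp add: pos_def_det1_def)
  then have "of_real ((rc_re (det R))\<^sup>2) = (1::'a)"
    using hermitian_det_real[OF pos_def_hermitian, of R] R by (metis of_real_mult power2_eq_square)
  then have "(rc_re (det R))\<^sup>2 = 1"
    by (metis of_real_eq_1_iff)
  then have "rc_re (det R) = 1"
    using pos_def_det_pos[of R] R by (simp add: power2_eq_1_iff)
  then have det: "det R = 1"
    using hermitian_det_real[OF pos_def_hermitian, of R] R by simp
  have u: "p + s > 0"
    using pos_def_trace_pos[of R] R by (simp add: h)
  have x1: "x + mat 1 = (p + s) *\<^sub>R R"
    using R det cayley_hamilton_2[of R]
    by (auto simp: vec_eq_iff forall_2 matrix_matrix_mult_def sum_2 mat_def h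
        matrix_scaleR_nth simp del: vector_scaleR_component)
  have "rc_re (det_polar (mat 1) x) + 2 = rc_re (det_polar (mat 1) (x + mat 1))"
    by (simp add: det_polar_id) (simp add: mat_def)
  also have "\<dots> = (p + s)\<^sup>2"
    by (simp add: x1 det_polar_scaleR det_polar_id h power2_eq_square)
  finally show "R = det1_sqrt x"
    using u by (simp add: det1_sqrt_def x1)
qed (use det1_sqrt[OF x] in \<open>auto simp: pos_def_det1_def\<close>)

subsection \<open>Matrix logarithm and distance\<close>

lemma matrix_add_rdistrib: "(A + B) ** C = A ** C + B ** (C :: 'a::semiring_1^'n^'n)"
  by (simp add: vec_eq_iff matrix_matrix_mult_def distrib_right sum.distrib)

lemma matrix_diff_ldistrib: "A ** (B - C) = A ** B - A ** (C :: 'a::ring_1^'n^'n)"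
  by (simp add: vec_eq_iff matrix_matrix_mult_def right_diff_distrib sum_subtractf)

text \<open>For \<open>\<rho> \<noteq> 0\<close>, \<open>P\<close> and \<open>Q\<close> are the
  spectral projections of \<open>N\<close> for \<open>\<rho>\<close> and \<open>- \<rho>\<close>.
  For \<open>\<rho> = 0\<close> the division yields 0, both become half the identity, and the
  formula survives because \<open>zero\<close> forces \<open>N = 0\<close>.\<close>

lemma mat_pow_spectral:
  fixes N :: "'k::real_or_complex^2^2"
  assumes sq: "N ** N = \<rho>\<^sup>2 *\<^sub>R mat 1" and zero: "\<rho> = 0 \<Longrightarrow> N = 0"
  defines "P \<equiv> (1 / 2) *\<^sub>R (mat 1 + (1 / \<rho>) *\<^sub>R N)" and "Q \<equiv> (1 / 2) *\<^sub>R (mat 1 - (1 / \<rho>) *\<^sub>R N)"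
  shows "mat_pow (m *\<^sub>R mat 1 + N) k = (m + \<rho>) ^ k *\<^sub>R P + (m - \<rho>) ^ k *\<^sub>R Q"
proof (induction k)
  case 0
  show ?case
    by (simp add: mat_pow_def P_def Q_def flip: scaleR_add_right)
next
  case (Suc k)
  let ?L = "m *\<^sub>R mat 1 + N"
  have P: "?L ** P = (m + \<rho>) *\<^sub>R P" and Q: "?L ** Q = (m - \<rho>) *\<^sub>R Q"
    unfolding P_def Q_def using sq zero
    by (cases "\<rho> = 0"; simp add: matrix_add_ldistrib matrix_add_rdistrib matrix_diff_ldistrib
        matrix_scaleR_left matrix_scaleR_right scaleR_add_right scaleR_diff_right scaleR_add_left
        scaleR_diff_left power2_eq_square diff_divide_distrib add_divide_distrib)+
  have "mat_pow ?L (Suc k) = ?L ** mat_pow ?L k"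
    by (simp add: mat_pow_def)
  also have "\<dots> = (m + \<rho>) ^ k *\<^sub>R (?L ** P) + (m - \<rho>) ^ k *\<^sub>R (?L ** Q)"
    unfolding Suc.IH matrix_add_ldistrib matrix_scaleR_right ..
  also have "\<dots> = (m + \<rho>) ^ Suc k *\<^sub>R P + (m - \<rho>) ^ Suc k *\<^sub>R Q"
    unfolding P Q by (simp add: mult.commute)
  finally show ?case .
qed

text \<open>The exponential series is summed on \<open>P\<close> and \<open>Q\<close> separately. At
  \<open>\<rho> = 0\<close> the quotient \<open>sinh \<rho> / \<rho>\<close> is 0 instead of its
  limit 1, which is harmless since then \<open>N = 0\<close>.\<close>

lemma mat_exp_spectral:
  fixes N :: "'k::real_or_complex^2^2"
  assumes sq: "N ** N = \<rho>\<^sup>2 *\<^sub>R mat 1" and zero: "\<rho> = 0 \<Longrightarrow> N = 0"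
  shows "mat_exp (m *\<^sub>R mat 1 + N) = exp m *\<^sub>R (cosh \<rho> *\<^sub>R mat 1 + (sinh \<rho> / \<rho>) *\<^sub>R N)"
proof -
  define P where "P = (1 / 2) *\<^sub>R (mat 1 + (1 / \<rho>) *\<^sub>R N)"
  define Q where "Q = (1 / 2) *\<^sub>R (mat 1 - (1 / \<rho>) *\<^sub>R N)"
  have "(\<lambda>k. (x ^ k /\<^sub>R fact k) *\<^sub>R A) sums (exp x *\<^sub>R A)" for x :: real and A :: "'k^2^2"
    by (intro sums_scaleR_left exp_converges)
  then have "(\<lambda>k. ((m + \<rho>) ^ k /\<^sub>R fact k) *\<^sub>R P + ((m - \<rho>) ^ k /\<^sub>R fact k) *\<^sub>R Q) sums
      (exp (m + \<rho>) *\<^sub>R P + exp (m - \<rho>) *\<^sub>R Q)"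
    by (intro sums_add)
  then have "(\<lambda>k. mat_pow (m *\<^sub>R mat 1 + N) k /\<^sub>R fact k) sums
      (exp (m + \<rho>) *\<^sub>R P + exp (m - \<rho>) *\<^sub>R Q)"
    using mat_pow_spectral[OF sq zero, folded P_def Q_def] by (simp add: scaleR_add_right)
  then have "mat_exp (m *\<^sub>R mat 1 + N) = exp (m + \<rho>) *\<^sub>R P + exp (m - \<rho>) *\<^sub>R Q"
    unfolding mat_exp_def by (rule sums_unique[symmetric])
  also have "\<dots> = exp m *\<^sub>R (cosh \<rho> *\<^sub>R mat 1 + (sinh \<rho> / \<rho>) *\<^sub>R N)"
  proof -
    have "exp (m + \<rho>) *\<^sub>R P + exp (m - \<rho>) *\<^sub>R Q = exp m *\<^sub>R (exp \<rho> *\<^sub>R P + exp (- \<rho>) *\<^sub>R Q)"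
      by (simp add: exp_add exp_diff exp_minus scaleR_add_right divide_inverse)
    also have "exp \<rho> *\<^sub>R P + exp (- \<rho>) *\<^sub>R Q =
        ((exp \<rho> + exp (- \<rho>)) / 2) *\<^sub>R mat 1 + ((exp \<rho> - exp (- \<rho>)) / 2 / \<rho>) *\<^sub>R N"
      by (simp add: P_def Q_def scaleR_add_right scaleR_diff_right scaleR_add_left scaleR_diff_left
          add_divide_distrib diff_divide_distrib)
    also have "\<dots> = cosh \<rho> *\<^sub>R mat 1 + (sinh \<rho> / \<rho>) *\<^sub>R N"
      by (simp add: cosh_field_def sinh_field_def)
    finally show ?thesis .
  qed
  finally show ?thesis .
qed

text \<open>Cayley-Hamilton with zero trace; it supplies the hypothesis \<open>sq\<close> of
  \<open>mat_exp_spectral\<close>.\<close>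

lemma traceless_herm_sq:
  "herm_mat q b (- q) ** herm_mat q b (- q) = (q\<^sup>2 + (norm b)\<^sup>2) *\<^sub>R mat 1"
  by (simp add: vec_eq_iff forall_2 matrix_matrix_mult_def sum_2 mat_def matrix_scaleR_nth
      rc_mult_cnj_of_real rc_cnj_mult_of_real power2_eq_square del: vector_scaleR_component)

lemma norm_herm_mat: "(norm (herm_mat p b s))\<^sup>2 = p\<^sup>2 + 2 * (norm b)\<^sup>2 + s\<^sup>2"
  by (simp add: power2_norm_eq_inner[of "herm_mat p b s"] inner_vec_def sum_2 flip: power2_norm_eq_inner)

lemma herm_mat_eq_0: "q\<^sup>2 + (norm b)\<^sup>2 = 0 \<Longrightarrow> herm_mat q b (- q) = 0"
  unfolding vec_eq_iff forall_2 by (simp add: sum_power2_eq_zero_iff)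

lemma herm_mat_decompose:
  "herm_mat p b s = ((p + s) / 2) *\<^sub>R mat 1 + herm_mat ((p - s) / 2) b (- ((p - s) / 2))"
  by (simp add: vec_eq_iff forall_2 mat_def matrix_scaleR_nth field_simps del: vector_scaleR_component)

lemma mat_exp_herm:
  fixes b :: "'k::real_or_complex"
  defines "\<rho> \<equiv> \<lambda>q b. sqrt (q\<^sup>2 + (norm b)\<^sup>2)"
  shows "mat_exp (m *\<^sub>R mat 1 + herm_mat q b (- q)) =
    exp m *\<^sub>R (cosh (\<rho> q b) *\<^sub>R mat 1 + (sinh (\<rho> q b) / \<rho> q b) *\<^sub>R herm_mat q b (- q))"
proof (rule mat_exp_spectral)
  show "herm_mat q b (- q) = 0" if "\<rho> q b = 0"
    using that by (intro herm_mat_eq_0) (simp add: \<rho>_def)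
qed (simp add: \<rho>_def traceless_herm_sq)

lemma scaleR_herm_mat: "r *\<^sub>R herm_mat p b s = herm_mat (r * p) (r *\<^sub>R b) (r * s)"
  by (simp add: vec_eq_iff forall_2 rc_cnj_mult scaleR_conv_of_real[of r b] matrix_scaleR_nth
      del: vector_scaleR_component)

text \<open>Let \<open>t\<close> be half the trace and \<open>N\<close> the traceless part of
  \<open>z\<close>. Determinant 1 says that \<open>N\<close> squares to \<open>t^2 - 1\<close>,
  which is \<open>sinh(\<rho>)^2\<close> when \<open>t = cosh \<rho>\<close>. So the logarithm is
  \<open>(\<rho> / sinh \<rho>) N\<close>, with eigenvalues \<open>\<rho>\<close> and
  \<open>- \<rho>\<close> and Frobenius norm \<open>sqrt 2 * \<rho>\<close>.\<close>

lemma cosh_mat_log_det1: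
  fixes z :: "'k::real_or_complex^2^2"
  assumes z: "z \<in> pos_def_det1"
  shows "cosh (norm (mat_log z) / sqrt 2) = rc_re (det_polar (mat 1) z) / 2"
proof -
  obtain p b s where h: "z = herm_mat p b s"
    using det1_hermitian[OF z] by (auto simp: hermitian_iff)
  have det: "p * s - (norm b)\<^sup>2 = 1"
    using z unfolding h pos_def_det1_def mem_Collect_eq det_herm_mat by (metis of_real_eq_1_iff)
  have pos: "p + s > 0"
    using z pos_def_trace_pos[of z] by (simp add: pos_def_det1_def h)
  define q where "q = (p - s) / 2"
  define t where "t = (p + s) / 2"
  have tq: "q\<^sup>2 + (norm b)\<^sup>2 = t\<^sup>2 - 1"
    using det by (simp add: q_def t_def power2_eq_square field_simps)
  have "t\<^sup>2 \<ge> 1"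
    using tq zero_le_power2[of q] zero_le_power2[of "norm b"] by linarith
  then have t: "t \<ge> 1"
    using pos power2_le_imp_le[of 1 t] by (auto simp: t_def)
  define \<rho> where "\<rho> = arcosh t"
  have \<rho>: "cosh \<rho> = t" "\<rho> \<ge> 0"
    using t by (auto simp: \<rho>_def cosh_arcosh_real)
  have sinh: "(sinh \<rho>)\<^sup>2 = q\<^sup>2 + (norm b)\<^sup>2"
    using cosh_square_eq[of \<rho>] by (simp add: tq \<rho>)
  have h': "z = t *\<^sub>R mat 1 + herm_mat q b (- q)"
    unfolding h t_def q_def by (rule herm_mat_decompose)
  define L where "L = (\<rho> / sinh \<rho>) *\<^sub>R herm_mat q b (- q)"
  have L: "L = herm_mat (\<rho> / sinh \<rho> * q) ((\<rho> / sinh \<rho>) *\<^sub>R b) (- (\<rho> / sinh \<rho> * q))"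
    by (simp add: L_def scaleR_herm_mat)
  have L\<rho>: "(\<rho> / sinh \<rho> * q)\<^sup>2 + (norm ((\<rho> / sinh \<rho>) *\<^sub>R b))\<^sup>2 = \<rho>\<^sup>2"
  proof -
    have "(\<rho> / sinh \<rho> * q)\<^sup>2 + (norm ((\<rho> / sinh \<rho>) *\<^sub>R b))\<^sup>2 = (\<rho> / sinh \<rho>)\<^sup>2 * (sinh \<rho>)\<^sup>2"
      by (simp only: sinh norm_scaleR power_mult_distrib power2_abs distrib_left)
    then show ?thesis
      by (cases "\<rho> = 0") (auto simp: power_divide)
  qed
  have zero: "\<rho> = 0 \<Longrightarrow> herm_mat q b (- q) = 0"
    using sinh by (intro herm_mat_eq_0) auto
  have "mat_exp L = z"
    using mat_exp_herm[of 0 "\<rho> / sinh \<rho> * q" "(\<rho> / sinh \<rho>) *\<^sub>R b"] \<rho>(2) zero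
    unfolding L\<rho> L[symmetric] by (auto simp: h' L_def \<rho>(1))
  moreover have "hermitian L"
    unfolding L hermitian_iff by blast
  \<comment> \<open>Uniqueness is needed against every Hermitian \<open>L'\<close>, traceless or
    not. The determinant of its exponential is \<open>exp(m)^2\<close>, forcing
    \<open>m = 0\<close>; the trace then fixes \<open>\<sigma> = \<rho>\<close>, and the traceless
    parts agree.\<close>
  moreover have "L' = L" if L': "hermitian L'" "mat_exp L' = z" for L'
  proof -
    obtain p' b' s' where "L' = herm_mat p' b' s'"
      using L' by (auto simp: hermitian_iff)
    then obtain m q' where L'_eq: "L' = m *\<^sub>R mat 1 + herm_mat q' b' (- q')"
      using herm_mat_decompose by blast
    define \<sigma> where "\<sigma> = sqrt (q'\<^sup>2 + (norm b')\<^sup>2)"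
    have \<sigma>: "\<sigma> \<ge> 0" "\<sigma>\<^sup>2 = q'\<^sup>2 + (norm b')\<^sup>2"
      by (auto simp: \<sigma>_def)
    define f where "f = sinh \<sigma> / \<sigma>"
    have f: "f * \<sigma> = sinh \<sigma>"
      by (simp add: f_def)
    have z_eq: "z = exp m *\<^sub>R (cosh \<sigma> *\<^sub>R mat 1 + f *\<^sub>R herm_mat q' b' (- q'))"
      using L'(2) unfolding L'_eq mat_exp_herm \<sigma>_def f_def by simp
    also have "cosh \<sigma> *\<^sub>R mat 1 + f *\<^sub>R herm_mat q' b' (- q') =
        herm_mat (cosh \<sigma> + f * q') (f *\<^sub>R b') (cosh \<sigma> - f * q')"
      by (simp add: vec_eq_iff forall_2 mat_def matrix_scaleR_nth rc_cnj_mult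
          scaleR_conv_of_real[of f b'] del: vector_scaleR_component)
    finally have z_herm: "z = exp m *\<^sub>R herm_mat (cosh \<sigma> + f * q') (f *\<^sub>R b') (cosh \<sigma> - f * q')" .
    have "rc_re (det z) = (exp m)\<^sup>2 * ((cosh \<sigma> + f * q') * (cosh \<sigma> - f * q') - (norm (f *\<^sub>R b'))\<^sup>2)"
      unfolding z_herm det_scaleR det_herm_mat rc_re_scaleR rc_re_of_real ..
    also have "(cosh \<sigma> + f * q') * (cosh \<sigma> - f * q') - (norm (f *\<^sub>R b'))\<^sup>2 = (cosh \<sigma>)\<^sup>2 - (f * \<sigma>)\<^sup>2"
      by (simp add: power_mult_distrib \<sigma>(2) algebra_simps) (simp add: power2_eq_square)
    also have "\<dots> = 1"
      using cosh_square_eq[of \<sigma>] by (simp add: f)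
    finally have "(exp m)\<^sup>2 = 1"
      using z by (simp add: pos_def_det1_def)
    then have m: "m = 0"
      by (simp add: power2_eq_1_iff) (metis exp_gt_zero less_numeral_extra(1) neg_less_0_iff_less not_less_iff_gr_or_eq)
    have "p + s = 2 * cosh \<sigma>"
    proof -
      have "p + s = rc_re (z$1$1 + z$2$2)"
        by (simp add: h)
      also have "\<dots> = 2 * cosh \<sigma>"
        using rc_re_of_real_mult[of 2 "of_real (cosh \<sigma>) :: 'k"] by (simp add: z_herm m)
      finally show ?thesis .
    qed
    then have "\<sigma> = \<rho>"
      using \<sigma>(1) by (simp add: \<rho>_def t_def arcosh_cosh_real)
    then have "herm_mat q b (- q) = f *\<^sub>R herm_mat q' b' (- q')"
      using z_eq h' m \<rho>(1) by simp
    then have "L = (\<rho> / sinh \<rho> * f) *\<^sub>R herm_mat q' b' (- q')"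
      by (simp add: L_def)
    moreover have "\<rho> = 0 \<Longrightarrow> herm_mat q' b' (- q') = 0"
      using \<sigma>(2) \<open>\<sigma> = \<rho>\<close> by (intro herm_mat_eq_0) auto
    ultimately have "L = herm_mat q' b' (- q')"
      using \<open>\<sigma> = \<rho>\<close> by (cases "\<rho> = 0") (auto simp: f_def)
    then show ?thesis
      by (simp add: L'_eq m)
  qed
  ultimately have log: "mat_log z = L"
    unfolding mat_log_def by (intro the_equality) blast+
  have "(norm L)\<^sup>2 = 2 * ((\<rho> / sinh \<rho> * q)\<^sup>2 + (norm ((\<rho> / sinh \<rho>) *\<^sub>R b))\<^sup>2)"
    unfolding L norm_herm_mat by simp
  then have "(norm L)\<^sup>2 = (sqrt 2 * \<rho>)\<^sup>2"
    unfolding L\<rho> by (simp add: power_mult_distrib)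
  then have "norm L = sqrt 2 * \<rho>"
    using \<rho>(2) by (subst (asm) power2_eq_iff_nonneg) auto
  moreover have "rc_re (det_polar (mat 1) z) = 2 * t"
    by (simp add: det_polar_id h t_def)
  ultimately show ?thesis
    by (simp add: log \<rho>)
qed

lemma adjugate_hermitian: "hermitian A \<Longrightarrow> hermitian (adjugate A)"
  by (auto simp: hermitian_iff adjugate_def vec_eq_iff forall_2 intro!: exI[of _ "- b" for b])

text \<open>Congruence by \<open>?Q\<close>, the inverse square root of \<open>x\<close>, has
  determinant 1 and so preserves \<open>det_polar\<close>; it carries \<open>x\<close> to the
  identity and \<open>y\<close> to the matrix whose logarithm is measured.\<close>

lemma cosh_ai_dist:
  fixes x y :: "'k::real_or_complex^2^2"
  assumes x: "x \<in> pos_def_det1" and y: "y \<in> pos_def_det1"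
  shows "cosh (ai_dist (1 / sqrt 2) x y) = rc_re (det_polar x y) / 2"
proof -
  let ?R = "det1_sqrt x"
  let ?Q = "adjugate ?R"
  have R: "det ?R = 1" "adj ?R = ?R"
    using det1_sqrt[OF x] det1_hermitian[of ?R] by (auto simp: pos_def_det1_def hermitian_def)
  have Q: "det ?Q = 1" "adj ?Q = ?Q"
    using R adjugate_hermitian[of ?R] by (auto simp: hermitian_def)
  have QR: "?Q ** ?R = mat 1" "?R ** ?Q = mat 1"
    by (simp_all add: adjugate_mult R)
  have inv: "matrix_inv (mat_sqrt x) = ?Q"
    using R by (simp add: mat_sqrt_det1[OF x] matrix_inv_det1)
  have z: "?Q ** y ** ?Q \<in> pos_def_det1"
    using det1_congruence[OF y Q(1)] by (simp add: Q)
  have "(?Q ** ?R) ** (?R ** ?Q) = ?Q ** (?R ** ?R) ** ?Q"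
    by (simp only: matrix_mul_assoc)
  then have "?Q ** x ** ?Q = mat 1"
    by (simp add: QR det1_sqrt(2)[OF x])
  then have "det_polar (mat 1) (?Q ** y ** ?Q) = det_polar x y"
    using det_polar_mult[of ?Q x ?Q y] Q by simp
  then show ?thesis
    using cosh_mat_log_det1[OF z] by (simp add: ai_dist_def inv)
qed

subsection \<open>Invariant volumes\<close>

lemma continuous_on_matrix_mult [continuous_intros]:
  fixes f g :: "'a::topological_space \<Rightarrow> 'k::real_normed_field^2^2"
  assumes "continuous_on S f" "continuous_on S g"
  shows "continuous_on S (\<lambda>x. f x ** g x)"
  unfolding matrix_matrix_mult_def by (intro continuous_intros assms)

lemma continuous_on_adj [continuous_intros]:
  "continuous_on S f \<Longrightarrow> continuous_on S (\<lambda>x. adj (f x))"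
  unfolding adj_def by (intro continuous_intros)

lemma continuous_on_det_2 [continuous_intros]:
  fixes f :: "'a::topological_space \<Rightarrow> 'k::real_normed_field^2^2"
  shows "continuous_on S f \<Longrightarrow> continuous_on S (\<lambda>x. det (f x))"
  unfolding det_2 by (intro continuous_intros)

lemma continuous_on_det_polar [continuous_intros]:
  fixes f g :: "'a::topological_space \<Rightarrow> 'k::real_normed_field^2^2"
  shows "continuous_on S f \<Longrightarrow> continuous_on S g \<Longrightarrow> continuous_on S (\<lambda>x. det_polar (f x) (g x))"
  unfolding det_polar_def by (intro continuous_intros)

text \<open>On determinant 1 the strict inequality for the corner entry may be weakened:
  \<open>p * s = 1 + (norm b)^2\<close> rules out \<open>p = 0\<close>.\<close>

lemma closed_pos_def_det1: "closed (pos_def_det1 :: ('k::real_or_complex^2^2) set)"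
proof -
  have "(pos_def_det1 :: ('k^2^2) set) =
      {A. adj A = A} \<inter> {A. det A = 1} \<inter> {A. 0 \<le> rc_re (A$1$1)}"
  proof -
    have "rc_re (A$1$1) > 0" if A: "hermitian A" "det A = 1" "0 \<le> rc_re (A$1$1)" for A :: "'k^2^2"
    proof -
      obtain p b s where h: "A = herm_mat p b s"
        using A(1) unfolding hermitian_iff by blast
      have "p * s - (norm b)\<^sup>2 = 1"
        using A(2) unfolding h det_herm_mat by (metis of_real_eq_1_iff)
      then have "p * s > 0"
        using zero_le_power2[of "norm b"] by linarith
      then have "p \<noteq> 0"
        by auto
      then show ?thesis
        using A(3) by (simp add: h)
    qed
    then show ?thesis
      by (auto simp: pos_def_det1_def pos_def_iff hermitian_def)
  qed
  also have "closed \<dots>"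
    by (intro closed_Int closed_Collect_eq closed_Collect_le continuous_intros)
  finally show ?thesis .
qed

lemma pos_def_borel [measurable]: "(pos_def :: ('k::real_or_complex^2^2) set) \<in> sets borel"
proof -
  have "(pos_def :: ('k^2^2) set) = {A. adj A = A} \<inter> ({A. 0 < rc_re (A$1$1)} \<inter> {A. 0 < rc_re (det A)})"
    by (auto simp: pos_def_iff hermitian_def)
  also have "\<dots> \<in> sets borel"
    by (intro sets.Int borel_closed borel_open closed_Collect_eq open_Collect_less continuous_intros)
  finally show ?thesis .
qed

lemma pos_def_det1_borel [measurable]: "pos_def_det1 \<in> sets borel"
  by (rule borel_closed[OF closed_pos_def_det1])

text \<open>Determinant 1 eliminates \<open>norm b\<close> in favour of the trace. The formula for
  the norm bounds trace-bounded sets; the one for \<open>dist\<close> shows that a trace near 2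
  means nearness to the identity.\<close>

lemma det1_trace_bound:
  fixes z :: "'k::real_or_complex^2^2"
  assumes "z \<in> pos_def_det1"
  defines "t \<equiv> rc_re (det_polar (mat 1) z)"
  shows "t > 0" "(norm z)\<^sup>2 = t\<^sup>2 - 2" "(dist z (mat 1))\<^sup>2 = t * (t - 2)"
proof -
  obtain p b s where h: "z = herm_mat p b s"
    using det1_hermitian[OF assms(1)] by (auto simp: hermitian_iff)
  have det: "p * s - (norm b)\<^sup>2 = 1"
    using assms unfolding h pos_def_det1_def mem_Collect_eq det_herm_mat by (metis of_real_eq_1_iff)
  have t: "t = p + s"
    by (simp add: t_def det_polar_id h)
  show "t > 0"
    using pos_def_trace_pos[of z] assms(1) by (simp add: pos_def_det1_def t_def det_polar_id)
  show "(norm z)\<^sup>2 = t\<^sup>2 - 2"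
    using det norm_herm_mat[of p b s] by (simp add: h t power2_eq_square algebra_simps)
  have "z - mat 1 = herm_mat (p - 1) b (s - 1)"
    by (simp add: vec_eq_iff forall_2 h mat_def)
  then show "(dist z (mat 1))\<^sup>2 = t * (t - 2)"
    using det norm_herm_mat[of "p - 1" b "s - 1"] by (simp add: dist_norm t power2_eq_square algebra_simps)
qed

lemma det_polar_congruence:
  "det G = 1 \<Longrightarrow> det_polar (G ** x ** adj G) (G ** y ** adj G) = det_polar x y"
  by (simp add: det_polar_mult det_adj)

text \<open>Transitivity of the action, witnessed by a Hermitian matrix of determinant 1.\<close>

lemma det1_sqrt_congruence:
  assumes "x \<in> pos_def_det1"
  shows "det1_sqrt x ** mat 1 ** adj (det1_sqrt x) = x" "det (det1_sqrt x) = 1"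
    "hermitian (det1_sqrt x)"
proof -
  show *: "det (det1_sqrt x) = 1" "hermitian (det1_sqrt x)"
    using det1_sqrt(1)[OF assms] by (auto simp: pos_def_det1_def pos_def_hermitian)
  show "det1_sqrt x ** mat 1 ** adj (det1_sqrt x) = x"
    using det1_sqrt(2)[OF assms] *(2) by (simp add: hermitian_def)
qed

lemma congruence_inverse:
  assumes "det G = 1"
  shows "G ** (adjugate G ** y ** adj (adjugate G)) ** adj G = y"
    "adjugate G ** (G ** y ** adj G) ** adj (adjugate G) = y"
proof -
  have "G ** (adjugate G ** y ** adj (adjugate G)) ** adj G =
      (G ** adjugate G) ** y ** adj (G ** adjugate G)"
    by (simp add: adj_mult matrix_mul_assoc)
  also have "\<dots> = y"
    by (simp add: adjugate_mult assms adj_mat_1)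
  finally show "G ** (adjugate G ** y ** adj (adjugate G)) ** adj G = y" .
  have "adjugate G ** (G ** y ** adj G) ** adj (adjugate G) =
      (adjugate G ** G) ** y ** adj (adjugate G ** G)"
    by (simp add: adj_mult matrix_mul_assoc)
  also have "\<dots> = y"
    by (simp add: adjugate_mult assms adj_mat_1)
  finally show "adjugate G ** (G ** y ** adj G) ** adj (adjugate G) = y" .
qed

text \<open>The shift by 2 is the value of \<open>det_polar x x\<close>. Small balls are compared
  with Euclidean ones at the identity, to which \<open>x\<close> is moved by its square
  root.\<close>

interpretation det1: distance_kernel
  "pos_def_det1 :: ('k::real_or_complex^2^2) set" "\<lambda>x y. rc_re (det_polar x y) - 2"
proof
  show "rc_re (det_polar x y) - 2 = rc_re (det_polar y x) - 2" for x y :: "'k^2^2"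
    by (simp add: det_polar_commute)
  show "rc_re (det_polar x x) - 2 = 0" if "x \<in> pos_def_det1" for x :: "'k^2^2"
    using that by (simp add: det_polar_self pos_def_det1_def)
  show "continuous_on (pos_def_det1 \<times> pos_def_det1)
      (\<lambda>(x, y). rc_re (det_polar x y) - 2 :: real)"
    unfolding case_prod_unfold by (intro continuous_intros)
  show "(pos_def_det1 :: ('k^2^2) set) \<in> sets borel"
    by simp
  fix U :: "('k^2^2) set" and x :: "'k^2^2"
  assume U: "open U" and x: "x \<in> U \<inter> pos_def_det1"
  let ?R = "det1_sqrt x"
  let ?\<phi> = "\<lambda>z. ?R ** z ** adj ?R"
  have R: "?\<phi> (mat 1) = x" "det ?R = 1"
    using det1_sqrt_congruence[of x] x by auto
  have "open (?\<phi> -` U)"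
    by (intro open_vimage U continuous_intros)
  moreover have "mat 1 \<in> ?\<phi> -` U"
    using R(1) x by (metis IntD1 vimageI)
  ultimately obtain \<epsilon> where \<epsilon>: "\<epsilon> > 0" "ball (mat 1) \<epsilon> \<subseteq> ?\<phi> -` U"
    by (rule openE)
  \<comment> \<open>The bound 1 keeps \<open>t\<close> below 3, so that
    \<open>t * (t - 2) \<le> 3 * (t - 2)\<close> when \<open>t \<ge> 2\<close>; the bound
    \<open>\<epsilon>\<^sup>2 / 3\<close> then brings the squared distance below
    \<open>\<epsilon>\<^sup>2\<close>.\<close>
  have "y \<in> U" if y: "y \<in> pos_def_det1" "rc_re (det_polar x y) - 2 < min 1 (\<epsilon>\<^sup>2 / 3)" for y
  proof -
    define z where "z = adjugate ?R ** y ** adj (adjugate ?R)"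
    have z: "z \<in> pos_def_det1" "?\<phi> z = y"
      using det1_congruence[OF y(1), of "adjugate ?R"] congruence_inverse[of ?R y] R
      by (auto simp: z_def)
    define t where "t = rc_re (det_polar (mat 1) z)"
    have "t - 2 < min 1 (\<epsilon>\<^sup>2 / 3)"
      using y(2) det_polar_congruence[OF R(2), of "mat 1" z] unfolding t_def R(1) z(2) by simp
    moreover have "t > 0" "(dist z (mat 1))\<^sup>2 = t * (t - 2)"
      using det1_trace_bound[OF z(1)] by (auto simp: t_def)
    moreover have "t * (t - 2) < \<epsilon>\<^sup>2"
    proof (cases "t \<ge> 2")
      case True
      then have "t * (t - 2) \<le> 3 * (t - 2)"
        using calculation by (intro mult_right_mono) auto
      then show ?thesis
        using calculation by auto
    next
      case False
      then have "t * (t - 2) \<le> 0"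
        using calculation by (intro mult_nonneg_nonpos) auto
      then show ?thesis
        using \<epsilon>(1) by (smt (verit) zero_less_power)
    qed
    ultimately have "dist z (mat 1) < \<epsilon>"
      using \<epsilon>(1) power2_less_imp_less[of "dist z (mat 1)" \<epsilon>] by simp
    then show ?thesis
      using \<epsilon>(2) z(2) by (auto simp: dist_commute)
  qed
  then show "\<exists>r>0. \<forall>y\<in>pos_def_det1. rc_re (det_polar x y) - 2 < r \<longrightarrow> y \<in> U"
    using \<epsilon>(1) by (intro exI[of _ "min 1 (\<epsilon>\<^sup>2 / 3)"]) auto
qed

lemma congruence_vimage_kball:
  assumes "det G = 1"
  shows "y \<in> pos_def_det1 \<Longrightarrow>
    G ** y ** adj G \<in> det1.kball (G ** x ** adj G) r \<longleftrightarrow> y \<in> det1.kball x r"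
  using det1_congruence[OF _ assms] det_polar_congruence[OF assms] by (simp add: det1.kball_def)

text \<open>Every ball is moved to the identity by a square root. Invariance is therefore asked for
  Hermitian \<open>G\<close> only, which is all that the frame measure will provide.\<close>

lemma uniform_if_congruence_invariant:
  fixes M :: "('k::real_or_complex^2^2) measure"
  assumes "sets M = sets (restrict_space borel pos_def_det1)" "emeasure M pos_def_det1 \<noteq> 0"
    and fin: "\<And>r. emeasure M (det1.kball (mat 1) r) < \<infinity>"
    and inv: "\<And>G x r. det G = 1 \<Longrightarrow> hermitian G \<Longrightarrow> x \<in> pos_def_det1 \<Longrightarrow>
      emeasure M (det1.kball (G ** x ** adj G) r) = emeasure M (det1.kball x r)"
  shows "det1.uniform M"
proof -
  have "emeasure M (det1.kball x r) = emeasure M (det1.kball (mat 1) r)"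
    if "x \<in> pos_def_det1" for x r
    using inv[OF det1_sqrt_congruence(2,3)[OF that] mat_1_det1] det1_sqrt_congruence(1)[OF that] by simp
  then show ?thesis
    using assms(1,2) fin by (simp add: det1.uniform_def)
qed

lemma compact_trace_bounded:
  "compact {z \<in> pos_def_det1 :: ('k::real_or_complex^2^2) set. rc_re (det_polar (mat 1) z) \<le> r}"
proof -
  have "closed (pos_def_det1 \<inter> {z :: 'k^2^2. rc_re (det_polar (mat 1) z) \<le> r})"
    by (intro closed_Int closed_pos_def_det1 closed_Collect_le continuous_intros)
  moreover have "norm z \<le> r"
    if "z \<in> pos_def_det1" "rc_re (det_polar (mat 1) z) \<le> r" for z :: "'k^2^2"
  proof -
    have "norm z \<le> rc_re (det_polar (mat 1) z)"
      by (rule power2_le_imp_le) (use det1_trace_bound(1,2)[OF that(1)] in linarith)+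
    with that(2) show ?thesis by simp
  qed
  then have "bounded (pos_def_det1 \<inter> {z :: 'k^2^2. rc_re (det_polar (mat 1) z) \<le> r})"
    by (intro boundedI[of _ r]) auto
  ultimately show ?thesis
    by (simp add: compact_eq_bounded_closed Int_def)
qed

text \<open>Balls lie in the compact sets of \<open>compact_trace_bounded\<close>, so finiteness on
  compact sets becomes finiteness on balls.\<close>

lemma invariant_volume_uniform:
  fixes \<nu> :: "('k::real_or_complex^2^2) measure"
  assumes "invariant_volume \<nu>"
  shows "det1.uniform \<nu>"
proof (rule uniform_if_congruence_invariant)
  show sets: "sets \<nu> = sets (restrict_space borel pos_def_det1)" "emeasure \<nu> pos_def_det1 \<noteq> 0"
    using assms by (auto simp: invariant_volume_def)
  have space: "space \<nu> = pos_def_det1"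
    using sets_eq_imp_space_eq[OF sets(1)] by (simp add: space_restrict_space)
  have kball: "det1.kball x r \<in> sets \<nu>" if "x \<in> pos_def_det1" for x r
    using det1.kball_open[OF that, of r] by (metis sets(1) sets_restrict_space borel_open imageI)
  show "emeasure \<nu> (det1.kball (mat 1) r) < \<infinity>" for r
  proof -
    let ?C = "{z \<in> pos_def_det1 :: ('k^2^2) set. rc_re (det_polar (mat 1) z) \<le> r + 2}"
    have "emeasure \<nu> (det1.kball (mat 1) r) \<le> emeasure \<nu> ?C"
    proof (rule emeasure_mono)
      show "?C \<in> sets \<nu>"
        using borel_closed[OF compact_imp_closed[OF compact_trace_bounded[of "r + 2"]]]
        by (auto simp: sets sets_restrict_space intro!: image_eqI[of _ _ ?C])
    qed (auto simp: det1.kball_def)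
    also have "\<dots> < \<infinity>"
      using assms compact_trace_bounded unfolding invariant_volume_def by blast
    finally show ?thesis .
  qed
  fix G x :: "'k^2^2" and r
  assume G: "det G = 1" and x: "x \<in> pos_def_det1"
  let ?\<phi> = "\<lambda>z. G ** z ** adj G"
  have "?\<phi> \<in> borel_measurable borel"
    by (intro borel_measurable_continuous_onI continuous_intros)
  then have meas: "?\<phi> \<in> measurable \<nu> \<nu>"
    using det1_congruence[OF _ G]
    by (subst measurable_cong_sets[OF sets(1) sets(1)])
      (auto intro!: measurable_restrict_space3)
  have "emeasure \<nu> (det1.kball (?\<phi> x) r) = emeasure (distr \<nu> \<nu> ?\<phi>) (det1.kball (?\<phi> x) r)"
    using assms G by (simp add: invariant_volume_def)
  also have "\<dots> = emeasure \<nu> (?\<phi> -` det1.kball (?\<phi> x) r \<inter> space \<nu>)"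
    using meas kball det1_congruence[OF x G] by (intro emeasure_distr) auto
  also have "?\<phi> -` det1.kball (?\<phi> x) r \<inter> space \<nu> = det1.kball x r"
    using congruence_vimage_kball[OF G, of _ x r] by (auto simp: space det1.kball_def)
  finally show "emeasure \<nu> (det1.kball (?\<phi> x) r) = emeasure \<nu> (det1.kball x r)" .
qed

subsection \<open>Linear images of Lebesgue measure\<close>

interpretation euclidean: distance_kernel "UNIV :: 'a::euclidean_space set" dist
proof
  show "open U \<Longrightarrow> x \<in> U \<inter> UNIV \<Longrightarrow> \<exists>r>0. \<forall>y\<in>UNIV. dist x y < r \<longrightarrow> y \<in> U" for U and x :: 'a
    by (force simp: open_contains_ball)
qed (auto simp: dist_commute case_prod_unfold intro!: continuous_intros)

lemma euclidean_kball: "euclidean.kball x r = ball x r"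
  by (auto simp: euclidean.kball_def)

lemma uniform_lborel: "euclidean.uniform (lborel :: 'a::euclidean_space measure)"
proof -
  have "emeasure lborel (ball x r) = emeasure lborel (ball y r)" for x y :: 'a and r
  proof -
    have "emeasure lborel (ball x r) = emeasure (distr lborel borel ((+) (x - y))) (ball x r)"
      by (simp add: lborel_distr_plus)
    also have "\<dots> = emeasure lborel ((+) (x - y) -` ball x r)"
      by (subst emeasure_distr) auto
    also have "(+) (x - y) -` ball x r = ball y r"
      by (auto simp: dist_norm algebra_simps)
    finally show ?thesis .
  qed
  then show ?thesis
    using emeasure_lborel_ball_finite unfolding euclidean.uniform_def euclidean_kball by auto
qed

text \<open>The image measure is again uniform: \<open>T\<close> is onto, so translations of the
  target lift to translations of the source, and \<open>T\<close> is bounded below, so preimages of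
  balls are bounded. The factor stays unidentified; relations between such factors suffice
  below.\<close>

lemma lborel_linear_vimage:
  fixes T :: "'a::euclidean_space \<Rightarrow> 'a"
  assumes T: "linear T" "inj T"
  obtains c :: real where "c > 0"
    "\<And>A. A \<in> sets borel \<Longrightarrow> emeasure lborel (T -` A) = ennreal c * emeasure lborel A"
proof -
  have meas [measurable]: "T \<in> borel_measurable borel"
    using T(1) by (simp add: borel_measurable_continuous_onI linear_continuous_on linear_linear)
  let ?M = "distr lborel borel T"
  have M: "emeasure ?M A = emeasure lborel (T -` A)" if "A \<in> sets borel" for A
    using that by (subst emeasure_distr) auto
  obtain B where B: "B > 0" "\<And>x. B * norm x \<le> norm (T x)"
    using linear_inj_bounded_below_pos[OF T] by blast
  have "euclidean.uniform ?M"
    unfolding euclidean.uniform_def euclidean_kball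
  proof (intro conjI allI ballI)
    show "emeasure ?M (ball x r) < \<infinity>" for x r
    proof -
      have "T -` ball x r \<subseteq> cball 0 ((norm x + r) / B)"
      proof
        fix y assume "y \<in> T -` ball x r"
        then have "norm (T y) \<le> norm x + r"
          using norm_triangle_ineq2[of "T y" x] by (auto simp: dist_norm norm_minus_commute)
        then show "y \<in> cball 0 ((norm x + r) / B)"
          using B(1) B(2)[of y] by (simp add: field_simps)
      qed
      then have "bounded (T -` ball x r)"
        using bounded_cball bounded_subset by blast
      then show ?thesis
        using emeasure_bounded_finite by (auto simp: M)
    qed
    show "emeasure ?M (ball x r) = emeasure ?M (ball y r)" for x y r
    proof -
      obtain a where a: "T a = x - y"
        using linear_injective_imp_surjective[OF T] by (metis surjD)
      have "emeasure lborel (T -` ball x r) = emeasure (distr lborel borel ((+) a)) (T -` ball x r)"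
        by (simp add: lborel_distr_plus)
      also have "\<dots> = emeasure lborel ((+) a -` T -` ball x r)"
        using measurable_sets_borel[OF meas, of "ball x r"] by (subst emeasure_distr) auto
      also have "(+) a -` T -` ball x r = T -` ball y r"
        by (auto simp: dist_norm linear_add[OF T(1)] a algebra_simps)
      finally show ?thesis
        by (simp add: M)
    qed
  qed (auto simp: M)
  then obtain c where c: "c > 0" "?M = density lborel (\<lambda>_. ennreal c)"
    by (rule euclidean.uniform_proportional[OF _ uniform_lborel])
  then have "emeasure lborel (T -` A) = ennreal c * emeasure lborel A" if "A \<in> sets borel" for A
    using M[OF that] that by (simp add: emeasure_density_const)
  with c(1) show thesis
    using that by blast
qed

lemma inj_matrix_vector_mult_det1:
  assumes "det (A :: 'a::comm_ring_1^2^2) = 1"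
  shows "inj ((*v) A)"
  by (rule inj_on_inverseI[where g = "(*v) (adjugate A)"])
    (simp add: matrix_vector_mul_assoc adjugate_mult assms)

lemma linear_matrix_vector_mult: "linear ((*v) (A :: 'k::real_or_complex^2^2))"
  by (rule linearI) (simp_all add: vec_eq_iff matrix_vector_mult_def sum_2 distrib_left
      scaleR_add_right)

text \<open>The antilinear map \<open>J v = (- cnj v\<^sub>2, cnj v\<^sub>1)\<close> satisfies \<open>J R = R\<^sup>-\<^sup>1 J\<close>, so \<open>R\<close> and
  \<open>R\<^sup>-\<^sup>1\<close> scale Lebesgue measure by the same factor.\<close>

lemma lborel_hermitian_det1:
  fixes R :: "'k::real_or_complex^2^2"
  assumes R: "hermitian R" "det R = 1" and A: "A \<in> sets borel"
  shows "emeasure lborel ((*v) R -` A) = emeasure lborel A"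
proof -
  let ?Q = "adjugate R"
  define J :: "'k^2 \<Rightarrow> 'k^2" where "J v = (\<chi> i. if i = 1 then - rc_cnj (v$2) else rc_cnj (v$1))" for v
  have J: "linear J" "inj J"
  proof -
    show "linear J"
      by (rule linearI) (auto simp: J_def vec_eq_iff rc_cnj_add rc_cnj_scaleR)
    have "J (J v) = - v" for v
      by (simp add: J_def vec_eq_iff forall_2 rc_cnj_cnj)
    then show "inj J"
      by (intro injI) (metis neg_equal_iff_equal)
  qed
  have JR: "J (R *v v) = ?Q *v J v" for v
    using R(1) by (auto simp: hermitian_iff J_def adjugate_def vec_eq_iff forall_2
        matrix_vector_mult_def sum_2 rc_cnj_add rc_cnj_mult rc_cnj_cnj)
  obtain r where r: "r > 0"
    "\<And>A. A \<in> sets borel \<Longrightarrow> emeasure lborel ((*v) R -` A) = ennreal r * emeasure lborel A"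
    using lborel_linear_vimage[OF linear_matrix_vector_mult inj_matrix_vector_mult_det1[OF R(2)]] by blast
  have "det ?Q = 1"
    by (simp add: R)
  then obtain q where q: "q > 0"
    "\<And>A. A \<in> sets borel \<Longrightarrow> emeasure lborel ((*v) ?Q -` A) = ennreal q * emeasure lborel A"
    using lborel_linear_vimage[OF linear_matrix_vector_mult inj_matrix_vector_mult_det1] by blast
  obtain j where j: "j > 0"
    "\<And>A. A \<in> sets borel \<Longrightarrow> emeasure lborel (J -` A) = ennreal j * emeasure lborel A"
    using lborel_linear_vimage[OF J] by blast
  have meas: "T -` A \<in> sets borel" if "linear T" "A \<in> sets borel" for T :: "'k^2 \<Rightarrow> 'k^2" and A
    using that by (intro measurable_sets_borel[of T borel] borel_measurable_continuous_onI
        linear_continuous_on) (auto simp: linear_linear)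
  \<comment> \<open>The unit ball, of positive finite measure, tests the factors \<open>r\<close>,
    \<open>q\<close>, \<open>j\<close> of \<open>R\<close>, its inverse \<open>?Q\<close> and
    \<open>J\<close>. The commutation \<open>JR\<close> gives \<open>r * j = j * q\<close>, and
    \<open>?Q\<close> after \<open>R\<close> being the identity gives \<open>r * q = 1\<close>;
    hence \<open>r = 1\<close>.\<close>
  define b where "b = measure lborel (ball (0::'k^2) 1)"
  have b: "emeasure lborel (ball (0::'k^2) 1) = ennreal b" "b > 0"
    using emeasure_lborel_ball_finite[of "0::'k^2" 1]
      euclidean.uniform_kball_pos[OF uniform_lborel, of 1 "0::'k^2"]
    by (auto simp: b_def emeasure_eq_ennreal_measure less_top euclidean_kball ennreal_less_zero_iff)
  let ?B = "ball (0::'k^2) 1"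
  have "(*v) R -` J -` ?B = J -` (*v) ?Q -` ?B"
    by (auto simp: JR)
  moreover have "emeasure lborel ((*v) R -` J -` ?B) = ennreal (r * j * b)"
    using r j b meas[OF J(1)] by (simp add: ennreal_mult mult.assoc)
  moreover have "emeasure lborel (J -` (*v) ?Q -` ?B) = ennreal (j * q * b)"
    using q j b meas[OF linear_matrix_vector_mult[of ?Q]] by (simp add: ennreal_mult mult.assoc)
  ultimately have "r * j * b = j * q * b"
    using r(1) j(1) b(2) q(1) by (simp add: ennreal_inj)
  then have "r = q"
    using j(1) b(2) by simp
  have "(*v) R -` (*v) ?Q -` ?B = ?B"
    by (auto simp: matrix_vector_mul_assoc adjugate_mult R)
  moreover have "emeasure lborel ((*v) R -` (*v) ?Q -` ?B) = ennreal (r * q * b)"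
    using r q b meas[OF linear_matrix_vector_mult[of ?Q]] by (simp add: ennreal_mult mult.assoc)
  ultimately have "r * q * b = b"
    using r(1) q(1) b by (simp add: ennreal_inj)
  then have "r = 1"
    using b(2) r(1) \<open>r = q\<close> by (simp add: power2_eq_1_iff flip: power2_eq_square)
  then show ?thesis
    using r(2)[OF A] by simp
qed

lemma lborel_scaleR_vimage:
  fixes A :: "'a::euclidean_space set"
  assumes "s > 0" "A \<in> sets borel"
  shows "emeasure lborel ((*\<^sub>R) s -` A) = ennreal ((1 / s) ^ DIM('a)) * emeasure lborel A"
proof -
  have "emeasure lborel A =
      emeasure (density (distr lborel borel ((*\<^sub>R) s)) (\<lambda>_. ennreal (s ^ DIM('a)))) A"
    using assms lborel_affine[of s "0::'a"] by simp
  also have "\<dots> = ennreal (s ^ DIM('a)) * emeasure lborel ((*\<^sub>R) s -` A)"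
    using assms by (subst emeasure_density_const) (simp_all add: emeasure_distr)
  finally have "emeasure lborel A = ennreal (s ^ DIM('a)) * emeasure lborel ((*\<^sub>R) s -` A)" .
  then have "ennreal ((1 / s) ^ DIM('a)) * emeasure lborel A =
      ennreal ((1 / s) ^ DIM('a) * s ^ DIM('a)) * emeasure lborel ((*\<^sub>R) s -` A)"
    using assms by (simp add: ennreal_mult mult.assoc)
  then show ?thesis
    using assms by (simp flip: power_mult_distrib)
qed

subsection \<open>Gram matrices\<close>

text \<open>Frames are indexed from 1, and this keeps \<open>1\<close> in \<open>{1..n}\<close> and
  \<open>Y 1\<close> from turning into \<open>Suc 0\<close>.\<close>

declare One_nat_def [simp del]

abbreviation lborel_family :: "nat \<Rightarrow> (nat \<Rightarrow> 'a::euclidean_space) measure" where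
  "lborel_family n \<equiv> \<Pi>\<^sub>M i\<in>{1..n}. lborel"

text \<open>Each of the \<open>n\<close> coordinates contributes a factor \<open>c\<close>; the
  rescaled image measure agrees with the product measure on boxes and hence everywhere.\<close>

lemma nn_integral_lborel_family_map:
  fixes T :: "'a::euclidean_space \<Rightarrow> 'a"
  assumes T [measurable]: "T \<in> borel_measurable borel" and c: "c > 0"
    and vimage: "\<And>A. A \<in> sets borel \<Longrightarrow> emeasure lborel (T -` A) = ennreal c * emeasure lborel A"
    and F [measurable]: "F \<in> borel_measurable (lborel_family n)"
  shows "(\<integral>\<^sup>+Y. F (\<lambda>i\<in>{1..n}. T (Y i)) \<partial>lborel_family n) =
    ennreal (c ^ n) * (\<integral>\<^sup>+Y. F Y \<partial>lborel_family n)"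
proof -
  interpret product_sigma_finite "\<lambda>_::nat. lborel :: 'a measure"
    by unfold_locales
  let ?L = "lborel_family n :: (nat \<Rightarrow> 'a) measure"
  let ?T = "\<lambda>Y. \<lambda>i\<in>{1..n}. T (Y i)"
  have meas [measurable]: "?T \<in> measurable ?L ?L"
    by measurable
  let ?P = "scale_measure (ennreal (1 / c ^ n)) (distr ?L ?L ?T)"
  have "?P = ?L"
  proof (rule PiM_eqI)
    fix A :: "nat \<Rightarrow> 'a set"
    assume A: "\<And>i. i \<in> {1..n} \<Longrightarrow> A i \<in> sets lborel"
    have T_A: "T -` A i \<in> sets borel" if "i \<in> {1..n}" for i
      using measurable_sets_borel[OF T] A[OF that] by simp
    have "?T -` Pi\<^sub>E {1..n} A \<inter> space ?L = (\<Pi>\<^sub>E i\<in>{1..n}. T -` A i)"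
      by (auto simp: space_PiM PiE_iff extensional_def)
    then have "emeasure (distr ?L ?L ?T) (Pi\<^sub>E {1..n} A) = emeasure ?L (\<Pi>\<^sub>E i\<in>{1..n}. T -` A i)"
      using A by (subst emeasure_distr) (auto intro!: sets_PiM_I_finite)
    also have "\<dots> = (\<Prod>i\<in>{1..n}. ennreal c * emeasure lborel (A i))"
      using A T_A by (subst emeasure_PiM) (auto intro!: prod.cong simp: vimage)
    also have "\<dots> = ennreal (c ^ n) * (\<Prod>i\<in>{1..n}. emeasure lborel (A i))"
      using c by (simp add: prod.distrib ennreal_power)
    finally show "emeasure ?P (Pi\<^sub>E {1..n} A) = (\<Prod>i\<in>{1..n}. emeasure lborel (A i))"
      using c by (simp add: mult.assoc[symmetric] flip: ennreal_mult)
  qed auto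
  then have "(\<integral>\<^sup>+Y. F Y \<partial>?L) = (\<integral>\<^sup>+Y. F Y \<partial>?P)"
    by simp
  also have "\<dots> = ennreal (1 / c ^ n) * (\<integral>\<^sup>+Y. F (?T Y) \<partial>?L)"
    by (simp add: nn_integral_scale_measure nn_integral_distr)
  finally show ?thesis
    using c by (simp add: mult.assoc[symmetric] flip: ennreal_mult)
qed

definition gram :: "nat \<Rightarrow> (nat \<Rightarrow> 'k::real_or_complex^2) \<Rightarrow> 'k^2^2" where
  "gram n Y = (\<Sum>i=1..n. outer_self (Y i))"

lemma continuous_on_outer_self: "continuous_on S outer_self"
  unfolding outer_self_def by (intro continuous_intros)

lemma gram_measurable [measurable]:
  "gram n \<in> borel_measurable (lborel_family n)"
proof -
  have [measurable]: "(outer_self :: 'a^2 \<Rightarrow> 'a^2^2) \<in> borel_measurable borel"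
    by (intro borel_measurable_continuous_onI continuous_on_outer_self)
  show ?thesis
    unfolding gram_def by measurable
qed

lemma outer_self_mult: "outer_self (G *v y) = G ** outer_self y ** adj G"
  by (simp add: outer_self_def vec_eq_iff forall_2 matrix_vector_mult_def matrix_matrix_mult_def
      sum_2 rc_cnj_add rc_cnj_mult algebra_simps)

lemma congruence_sum: "G ** (\<Sum>i\<in>I. f i) ** H = (\<Sum>i\<in>I. G ** f i ** (H :: 'a::comm_ring_1^2^2))"
proof (induction I rule: infinite_finite_induct)
  case (insert i I)
  then show ?case
    by (simp add: matrix_add_ldistrib matrix_add_rdistrib)
qed auto

lemma gram_mult: "gram n (\<lambda>i\<in>{1..n}. G *v Y i) = G ** gram n Y ** adj G"
  by (simp add: gram_def outer_self_mult congruence_sum)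

lemma gram_scaleR: "gram n (\<lambda>i\<in>{1..n}. s *\<^sub>R Y i) = s\<^sup>2 *\<^sub>R gram n Y"
proof -
  have "outer_self (s *\<^sub>R y) = s\<^sup>2 *\<^sub>R outer_self y" for y :: "'a^2"
    by (simp add: outer_self_def vec_eq_iff rc_cnj_scaleR power2_eq_square)
  then show ?thesis
    by (simp add: gram_def scaleR_sum_right)
qed

lemma rc_re_mult_cnj: "rc_re (x * rc_cnj x) = (norm x)\<^sup>2"
  using rc_mult_cnj_of_real[of x] rc_re_of_real by metis

text \<open>\<open>det_polar A B\<close> is the trace of \<open>adjugate A ** B\<close>. Through
  this identity the Gaussian exponent becomes linear in the Gram matrix.\<close>

lemma det_polar_outer_self: "y \<bullet> (adjugate A *v y) = rc_re (det_polar A (outer_self y))"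
  by (simp add: inner_vec_def sum_2 rc_inner_eq matrix_vector_mult_def adjugate_def det_polar_def
      outer_self_def algebra_simps)

lemma det_polar_sum: "det_polar A (\<Sum>i\<in>I. f i) = (\<Sum>i\<in>I. det_polar A (f i))"
  by (simp add: det_polar_def sum.distrib sum_subtractf sum_distrib_left)

lemma sum_inner_adjugate:
  "(\<Sum>i=1..n. Y i \<bullet> (adjugate A *v Y i)) = rc_re (det_polar A (gram n Y))"
  by (simp add: gram_def det_polar_sum rc_re_sum det_polar_outer_self)

lemma trace_gram:
  fixes Y :: "nat \<Rightarrow> 'k::real_or_complex^2"
  shows "rc_re (det_polar (mat 1) (gram n Y)) = (\<Sum>i=1..n. (norm (Y i))\<^sup>2)"
proof -
  have "adjugate (mat 1) = (mat 1 :: 'k^2^2)"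
    by (simp add: adjugate_def vec_eq_iff forall_2 mat_def)
  then show ?thesis
    using sum_inner_adjugate[of Y "mat 1" n] by (simp add: power2_norm_eq_inner)
qed

text \<open>The two conditions are open, satisfiable, and constrain \<open>Y 1\<close> and
  \<open>Y 2\<close> separately, so they cut out a box of frames. A vector \<open>v\<close>
  annihilated by the form is orthogonal to both, which forces the norms of its two coordinates to
  agree and then to vanish.\<close>

lemma gram_pos_def:
  fixes Y :: "nat \<Rightarrow> 'k::real_or_complex^2"
  assumes n: "n \<ge> 2" and Y: "norm (Y 1 $ 2) < norm (Y 1 $ 1)" "norm (Y 2 $ 1) < norm (Y 2 $ 2)"
  shows "gram n Y \<in> pos_def"
proof -
  have form: "v \<bullet> (outer_self y *v v) = (norm (rc_cnj (y$1) * v$1 + rc_cnj (y$2) * v$2))\<^sup>2" for y v :: "'k^2"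
  proof -
    have "v \<bullet> (outer_self y *v v) = rc_re ((rc_cnj (y$1) * v$1 + rc_cnj (y$2) * v$2) *
        rc_cnj (rc_cnj (y$1) * v$1 + rc_cnj (y$2) * v$2))"
      by (simp add: inner_vec_def sum_2 rc_inner_eq matrix_vector_mult_def outer_self_def
          rc_cnj_add rc_cnj_mult rc_cnj_cnj algebra_simps)
    then show ?thesis
      by (simp only: rc_re_mult_cnj)
  qed
  have "v \<bullet> (gram n Y *v v) > 0" if v: "v \<noteq> 0" for v
  proof -
    have expand: "v \<bullet> (gram n Y *v v) = (\<Sum>i=1..n. v \<bullet> (outer_self (Y i) *v v))"
    proof -
      have "(\<Sum>i\<in>I. outer_self (Y i)) *v v = (\<Sum>i\<in>I. outer_self (Y i) *v v)" for I
        by (induction I rule: infinite_finite_induct) (auto simp: matrix_vector_mult_add_rdistrib)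
      then show ?thesis
        by (simp add: gram_def inner_sum_right)
    qed
    have "\<exists>i\<in>{1..n}. v \<bullet> (outer_self (Y i) *v v) > 0"
    proof (rule ccontr)
      assume "\<not> ?thesis"
      then have 0: "rc_cnj (Y i $ 1) * v$1 + rc_cnj (Y i $ 2) * v$2 = 0" if "i \<in> {1..n}" for i
        using that by (force simp: form)
      have "norm (Y i $ 1) * norm (v$1) = norm (Y i $ 2) * norm (v$2)" if "i \<in> {1..n}" for i
      proof -
        have "norm (rc_cnj (Y i $ 1) * v$1) = norm (- (rc_cnj (Y i $ 2) * v$2))"
          using 0[OF that] by (simp only: add_eq_0_iff minus_minus)
        then show ?thesis
          by (simp add: norm_mult)
      qed
      from this[of 1] this[of 2] have eq: "norm (Y 1 $ 1) * norm (v$1) = norm (Y 1 $ 2) * norm (v$2)"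
        "norm (Y 2 $ 1) * norm (v$1) = norm (Y 2 $ 2) * norm (v$2)"
        using n by auto
      have "norm (v$1) \<le> norm (v$2)"
      proof (rule ccontr)
        assume less: "\<not> ?thesis"
        then have "norm (Y 1 $ 2) * norm (v$2) \<le> norm (Y 1 $ 2) * norm (v$1)"
          by (intro mult_left_mono) auto
        also have "\<dots> < norm (Y 1 $ 1) * norm (v$1)"
          using Y(1) less by (intro mult_strict_right_mono) (auto intro: le_less_trans[OF norm_ge_zero])
        finally show False
          using eq(1) by simp
      qed
      moreover have "norm (v$2) \<le> norm (v$1)"
      proof (rule ccontr)
        assume less: "\<not> ?thesis"
        then have "norm (Y 2 $ 1) * norm (v$1) \<le> norm (Y 2 $ 1) * norm (v$2)"
          by (intro mult_left_mono) auto
        also have "\<dots> < norm (Y 2 $ 2) * norm (v$2)"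
          using Y(2) less by (intro mult_strict_right_mono) (auto intro: le_less_trans[OF norm_ge_zero])
        finally show False
          using eq(2) by simp
      qed
      ultimately have "(norm (Y 1 $ 1) - norm (Y 1 $ 2)) * norm (v$1) = 0" "norm (v$1) = norm (v$2)"
        using eq(1) by (auto simp: algebra_simps)
      then have "v = 0"
        using Y(1) by (auto simp: vec_eq_iff forall_2)
      with v show False ..
    qed
    then show ?thesis
      unfolding expand using form by (auto intro!: sum_pos2)
  qed
  moreover have "hermitian (gram n Y)"
    by (simp add: hermitian_def vec_eq_iff gram_def outer_self_def rc_cnj_sum rc_cnj_mult rc_cnj_cnj mult.commute)
  ultimately show ?thesis
    by (simp add: pos_def_def)
qed

section \<open>The shell and the volume it induces on shapes\<close>

lemma det_proj_det1:
  assumes "X \<in> pos_def"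
  shows "X = sqrt (rc_re (det X)) *\<^sub>R proj_det1 X"
  using pos_def_det_pos[OF assms] by (simp add: proj_det1_def powr_minus powr_half_sqrt)

lemma proj_det1_borel [measurable]:
  "(proj_det1 :: 'k::real_or_complex^2^2 \<Rightarrow> _) \<in> borel_measurable borel"
proof -
  have [measurable]: "(\<lambda>X :: 'k^2^2. rc_re (det X)) \<in> borel_measurable borel"
    by (intro borel_measurable_continuous_onI continuous_intros)
  show ?thesis
    unfolding proj_det1_def by measurable
qed

lemma det_borel [measurable]:
  "(\<lambda>X :: 'k::real_or_complex^2^2. rc_re (det X)) \<in> borel_measurable borel"
  by (intro borel_measurable_continuous_onI continuous_intros)

text \<open>Confining the radial coordinate to a bounded interval makes the image of Lebesgue measure finite
  on balls of shapes.\<close>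

definition shell :: "nat \<Rightarrow> (nat \<Rightarrow> 'k::real_or_complex^2) set" where
  "shell n = {Y \<in> space (lborel_family n). gram n Y \<in> pos_def \<and>
     sqrt (rc_re (det (gram n Y))) \<in> {1<..<2}}"

definition shape_volume :: "nat \<Rightarrow> ('k::real_or_complex^2^2) measure" where
  "shape_volume n = distr (restrict_space (lborel_family n) (shell n))
     (restrict_space borel pos_def_det1) (\<lambda>Y. proj_det1 (gram n Y))"

lemma shell_sets [measurable]: "shell n \<in> sets (lborel_family n)"
  unfolding shell_def by measurable

lemma shape_measurable:
  "(\<lambda>Y. proj_det1 (gram n Y)) \<in>
     measurable (restrict_space (lborel_family n) (shell n)) (restrict_space borel pos_def_det1)"
  by (rule measurable_restrict_space3) (auto simp: shell_def intro: proj_det1_mem)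

lemma sets_shape_volume: "sets (shape_volume n) = sets (restrict_space borel pos_def_det1)"
  by (simp add: shape_volume_def)

lemma nn_integral_shape_volume:
  assumes [measurable]: "f \<in> borel_measurable borel"
  shows "(\<integral>\<^sup>+x. f x \<partial>shape_volume n) =
    (\<integral>\<^sup>+Y. f (proj_det1 (gram n Y)) * indicator (shell n) Y \<partial>lborel_family n)"
proof -
  have "f \<in> borel_measurable (restrict_space borel pos_def_det1)"
    by (rule measurable_restrict_space1) simp
  then have "(\<integral>\<^sup>+x. f x \<partial>shape_volume n) =
      (\<integral>\<^sup>+Y. f (proj_det1 (gram n Y)) \<partial>restrict_space (lborel_family n) (shell n))"
    unfolding shape_volume_def by (intro nn_integral_distr shape_measurable) simp
  also have "\<dots> = (\<integral>\<^sup>+Y. f (proj_det1 (gram n Y)) * indicator (shell n) Y \<partial>lborel_family n)"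
    by (rule nn_integral_restrict_space) simp
  finally show ?thesis .
qed

lemma emeasure_shape_volume:
  assumes "A \<in> sets borel" "A \<subseteq> pos_def_det1"
  shows "emeasure (shape_volume n) A =
    (\<integral>\<^sup>+Y. indicator A (proj_det1 (gram n Y)) * indicator (shell n) Y \<partial>lborel_family n)"
proof -
  have "A \<in> sets (shape_volume n)"
    using assms by (auto simp: sets_shape_volume sets_restrict_space)
  then show ?thesis
    using assms by (simp flip: nn_integral_indicator nn_integral_shape_volume)
qed

lemma kball_subset: "det1.kball x r \<subseteq> pos_def_det1"
  by (auto simp: det1.kball_def)

lemma kball_borel: "x \<in> pos_def_det1 \<Longrightarrow> det1.kball x r \<in> sets borel"
  using det1.kball_open[of x r] pos_def_det1_borel by (metis borel_open sets.Int)

text \<open>The trace of the Gram matrix is the sum of the \<open>(norm (Y i))\<^sup>2\<close>. In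
  the shell it is less than twice the trace of the shape, which is below \<open>r + 2\<close> on the
  ball, so all vectors of the frame are bounded.\<close>

lemma emeasure_shape_volume_kball_finite: "emeasure (shape_volume n) (det1.kball (mat 1) r) < \<infinity>"
proof -
  interpret product_sigma_finite "\<lambda>_::nat. lborel :: ('a^2) measure"
    by unfold_locales
  let ?L = "lborel_family n :: (nat \<Rightarrow> 'a^2) measure"
  let ?K = "det1.kball (mat 1) r :: ('a^2^2) set"
  let ?B = "\<Pi>\<^sub>E i\<in>{1..n}. cball (0::'a^2) (sqrt (2 * (r + 2)))"
  have "indicator ?K (proj_det1 (gram n Y)) * indicator (shell n) Y \<le> (indicator ?B Y :: ennreal)"
    if Y: "Y \<in> space ?L" for Y
  proof (cases "proj_det1 (gram n Y) \<in> ?K \<and> Y \<in> shell n")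
    case True
    let ?X = "gram n Y"
    let ?\<delta> = "sqrt (rc_re (det ?X))"
    have X: "?X = ?\<delta> *\<^sub>R proj_det1 ?X" and \<delta>: "1 < ?\<delta>" "?\<delta> < 2"
      using True det_proj_det1[of ?X] by (auto simp: shell_def)
    have tr: "rc_re (det_polar (mat 1) (proj_det1 ?X)) < r + 2"
      "rc_re (det_polar (mat 1) (proj_det1 ?X)) > 0"
      using True det1_trace_bound(1)[of "proj_det1 ?X"] by (auto simp: det1.kball_def)
    have "rc_re (det_polar (mat 1) ?X) = ?\<delta> * rc_re (det_polar (mat 1) (proj_det1 ?X))"
      by (subst X) (simp only: det_polar_scaleR rc_re_scaleR)
    also have "\<dots> \<le> 2 * (r + 2)"
      using tr \<delta> by (intro mult_mono) auto
    finally have "(\<Sum>i=1..n. (norm (Y i))\<^sup>2) \<le> 2 * (r + 2)"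
      by (simp add: trace_gram)
    moreover have "(norm (Y i))\<^sup>2 \<le> (\<Sum>i=1..n. (norm (Y i))\<^sup>2)" if "i \<in> {1..n}" for i
      using that by (intro member_le_sum) auto
    ultimately have "norm (Y i) \<le> sqrt (2 * (r + 2))" if "i \<in> {1..n}" for i
      using that by (intro real_le_rsqrt) force
    then have "Y \<in> ?B"
      using Y by (auto simp: space_PiM PiE_iff)
    then show ?thesis
      by (simp add: indicator_def)
  qed (auto simp: indicator_def)
  then have "emeasure (shape_volume n) ?K \<le> (\<integral>\<^sup>+Y. indicator ?B Y \<partial>?L)"
    unfolding emeasure_shape_volume[OF kball_borel[OF mat_1_det1] kball_subset]
    by (intro nn_integral_mono)
  also have "\<dots> = (\<Prod>i\<in>{1..n}. emeasure lborel (cball (0::'a^2) (sqrt (2 * (r + 2)))))"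
  proof -
    have "?B \<in> sets ?L"
      by (intro sets_PiM_I_finite) auto
    then show ?thesis
      by (simp only: nn_integral_indicator) (rule emeasure_PiM; simp)
  qed
  also have "\<dots> < \<infinity>"
    using emeasure_lborel_cball_finite[of "0::'a^2" "sqrt (2 * (r + 2))"]
    by (simp add: power_less_top_ennreal)
  finally show ?thesis .
qed

text \<open>Applying \<open>G\<close> to every vector of a frame preserves Lebesgue measure, acts on
  shapes by congruence, and fixes the determinant of the Gram matrix and with it the shell.\<close>

lemma emeasure_shape_volume_congruence:
  fixes G :: "'k::real_or_complex^2^2"
  assumes G: "det G = 1" "hermitian G" and x: "x \<in> pos_def_det1"
  shows "emeasure (shape_volume n) (det1.kball (G ** x ** adj G) r) =
    emeasure (shape_volume n) (det1.kball x r)"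
proof -
  let ?L = "lborel_family n :: (nat \<Rightarrow> 'k^2) measure"
  let ?G = "\<lambda>Y. \<lambda>i\<in>{1..n}. G *v Y i"
  define F :: "(nat \<Rightarrow> 'k^2) \<Rightarrow> ennreal" where
    "F Y = indicator (det1.kball (G ** x ** adj G) r) (proj_det1 (gram n Y)) * indicator (shell n) Y" for Y
  have Gx: "G ** x ** adj G \<in> pos_def_det1"
    by (rule det1_congruence[OF x G(1)])
  note kball_borel[OF Gx, measurable] kball_borel[OF x, measurable]
  have [measurable]: "F \<in> borel_measurable ?L"
    unfolding F_def by measurable
  have Q: "det (adjugate G) = 1"
    by (simp add: G)
  have pd: "G ** A ** adj G \<in> pos_def \<longleftrightarrow> A \<in> pos_def" for A
    using pos_def_congruence[of A G] pos_def_congruence[of "G ** A ** adj G" "adjugate G"]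
      congruence_inverse(2)[OF G(1), of A] G(1) Q by auto
  have "F (?G Y) = indicator (det1.kball x r) (proj_det1 (gram n Y)) * indicator (shell n) Y"
    if "Y \<in> space ?L" for Y
  proof -
    have "?G Y \<in> shell n \<longleftrightarrow> Y \<in> shell n"
      using that by (simp add: shell_def gram_mult pd det_mul det_adj G(1) space_PiM)
    moreover have "proj_det1 (gram n (?G Y)) \<in> det1.kball (G ** x ** adj G) r \<longleftrightarrow>
        proj_det1 (gram n Y) \<in> det1.kball x r" if "Y \<in> shell n"
      using that proj_det1_mem[of "gram n Y"] congruence_vimage_kball[OF G(1), of "proj_det1 (gram n Y)" x r]
      by (auto simp: shell_def gram_mult proj_det1_congruence[OF G(1)])
    ultimately show ?thesis
      by (auto simp: F_def indicator_def)
  qed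
  then have "(\<integral>\<^sup>+Y. F (?G Y) \<partial>?L) = emeasure (shape_volume n) (det1.kball x r)"
    unfolding emeasure_shape_volume[OF kball_borel[OF x] kball_subset]
    by (intro nn_integral_cong)
  moreover have "(\<integral>\<^sup>+Y. F Y \<partial>?L) = emeasure (shape_volume n) (det1.kball (G ** x ** adj G) r)"
    unfolding emeasure_shape_volume[OF kball_borel[OF Gx] kball_subset] F_def ..
  moreover have "(\<integral>\<^sup>+Y. F (?G Y) \<partial>?L) = ennreal (1 ^ n) * (\<integral>\<^sup>+Y. F Y \<partial>?L)"
    using linear_matrix_vector_mult[of G] lborel_hermitian_det1[OF G(2,1)]
    by (intro nn_integral_lborel_family_map)
      (auto intro!: borel_measurable_continuous_onI linear_continuous_on simp: linear_linear)
  ultimately show ?thesis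
    by simp
qed

subsection \<open>Integration in polar coordinates\<close>

lemma nn_integral_lborel_family_scaleR:
  fixes F :: "(nat \<Rightarrow> 'a::euclidean_space) \<Rightarrow> ennreal"
  assumes "s > 0" "F \<in> borel_measurable (lborel_family n)"
  shows "(\<integral>\<^sup>+Y. F (\<lambda>i\<in>{1..n}. s *\<^sub>R Y i) \<partial>lborel_family n) =
    ennreal ((1 / s) ^ (DIM('a) * n)) * (\<integral>\<^sup>+Y. F Y \<partial>lborel_family n)"
  using nn_integral_lborel_family_map[of "(*\<^sub>R) s" "(1 / s) ^ DIM('a)" F n] assms
  by (simp add: lborel_scaleR_vimage flip: power_mult)

text \<open>Euler's integral for the factorial, rescaled by \<open>c\<close>. The open half-line
  keeps \<open>t\<close> positive, as it later becomes a denominator and a dilation.\<close>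

lemma nn_integral_power_exp:
  fixes c :: real
  assumes "c > 0" "p \<ge> 1"
  shows "(\<integral>\<^sup>+t. ennreal (t ^ (p - 1) * exp (- (t * c))) * indicator {0<..} t \<partial>lborel) =
    ennreal (fact (p - 1) / c ^ p)"
proof -
  let ?f = "\<lambda>x::real. ennreal (x ^ (p - 1) * exp (- x)) * indicator {0..} x"
  have "ennreal (fact (p - 1)) = (\<integral>\<^sup>+x. ?f x \<partial>lborel)"
    by (subst nn_intergal_power_times_exp_Ici) simp
  also have "\<dots> = ennreal c * (\<integral>\<^sup>+t. ?f (0 + c * t) \<partial>lborel)"
    using assms by (subst nn_integral_real_affine[where c = c and t = 0]) auto
  also have "(\<integral>\<^sup>+t. ?f (0 + c * t) \<partial>lborel) =
      (\<integral>\<^sup>+t. ennreal (c ^ (p - 1)) * (ennreal (t ^ (p - 1) * exp (- (t * c))) * indicator {0<..} t) \<partial>lborel)"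
  proof (rule nn_integral_cong_AE)
    have "AE t in lborel. t \<noteq> (0::real)"
      by (rule AE_lborel_singleton)
    then show "AE t in lborel. ?f (0 + c * t) =
        ennreal (c ^ (p - 1)) * (ennreal (t ^ (p - 1) * exp (- (t * c))) * indicator {0<..} t)"
      by eventually_elim
        (use assms in \<open>auto simp: indicator_def zero_le_mult_iff power_mult_distrib mult_ac
          simp flip: ennreal_mult\<close>)
  qed
  also have "\<dots> = ennreal (c ^ (p - 1)) *
      (\<integral>\<^sup>+t. ennreal (t ^ (p - 1) * exp (- (t * c))) * indicator {0<..} t \<partial>lborel)"
    by (rule nn_integral_cmult) simp
  finally have "ennreal (fact (p - 1)) = ennreal (c ^ p) *
      (\<integral>\<^sup>+t. ennreal (t ^ (p - 1) * exp (- (t * c))) * indicator {0<..} t \<partial>lborel)"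
    using assms by (cases p) (simp_all add: ennreal_mult mult.assoc)
  then have "ennreal (1 / c ^ p) * ennreal (fact (p - 1)) = ennreal (1 / c ^ p) * ennreal (c ^ p) *
      (\<integral>\<^sup>+t. ennreal (t ^ (p - 1) * exp (- (t * c))) * indicator {0<..} t \<partial>lborel)"
    by (simp add: mult.assoc)
  then show ?thesis
    using assms by (simp flip: ennreal_mult)
qed

text \<open>What remains of the dilation integral once the shell condition sits on
  \<open>\<delta> / t\<close>: the substitution \<open>t = \<delta> * v\<close> removes
  \<open>\<delta>\<close>. Only positivity and finiteness of the value matter.\<close>

definition shell_const :: "nat \<Rightarrow> ennreal" where
  "shell_const p =
     (\<integral>\<^sup>+v. ennreal ((1 / v) ^ (p + 1)) * indicator {1<..<2} (1 / v) * indicator {0<..} v \<partial>lborel)"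

lemma shell_const: "shell_const p \<noteq> 0" "shell_const p \<noteq> \<infinity>"
proof -
  have dom: "indicator {1<..<2} (1 / v) * indicator {0<..} v = (indicator {1/2<..<1} v :: ennreal)" for v :: real
    by (auto simp: indicator_def field_simps)
  have eq: "shell_const p = (\<integral>\<^sup>+v. ennreal ((1 / v) ^ (p + 1)) * indicator {1/2<..<1::real} v \<partial>lborel)"
    unfolding shell_const_def mult.assoc dom ..
  have "(\<integral>\<^sup>+v. 1 * indicator {1/2<..<1::real} v \<partial>lborel) \<le> shell_const p"
    unfolding eq
  proof (rule nn_integral_mono)
    fix v :: real
    show "1 * indicator {1/2<..<1} v \<le> ennreal ((1 / v) ^ (p + 1)) * indicator {1/2<..<1} v"
      using one_le_power[of "1 / v" "p + 1"] by (auto simp: indicator_def simp del: power_Suc)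
  qed
  then show "shell_const p \<noteq> 0"
    by auto
  have "shell_const p \<le> (\<integral>\<^sup>+v. ennreal (2 ^ (p + 1)) * indicator {1/2<..<1::real} v \<partial>lborel)"
    unfolding eq
  proof (rule nn_integral_mono)
    fix v :: real
    show "ennreal ((1 / v) ^ (p + 1)) * indicator {1/2<..<1} v \<le> ennreal (2 ^ (p + 1)) * indicator {1/2<..<1} v"
      using power_mono[of "1 / v" 2 "p + 1"]
      by (auto simp: indicator_def field_simps simp del: power_Suc intro!: ennreal_leI)
  qed
  also have "\<dots> = ennreal (2 ^ (p + 1)) * ennreal (1 / 2)"
    by (subst nn_integral_cmult_indicator) auto
  also have "\<dots> = ennreal (2 ^ (p + 1) * (1 / 2))"
    by (rule ennreal_mult[symmetric]) auto
  also have "\<dots> < \<infinity>"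
    by (simp only: ennreal_less_top infinity_ennreal_def)
  finally show "shell_const p \<noteq> \<infinity>"
    by simp
qed

lemma nn_integral_shell_scale:
  fixes \<delta> :: real
  assumes "\<delta> > 0"
  shows "(\<integral>\<^sup>+t. ennreal (1 / t * (\<delta> / t) ^ p) * indicator {1<..<2} (\<delta> / t) * indicator {0<..} t \<partial>lborel) =
    shell_const p"
proof -
  have "(\<integral>\<^sup>+t. ennreal (1 / t * (\<delta> / t) ^ p) * indicator {1<..<2} (\<delta> / t) * indicator {0<..} t \<partial>lborel) =
    ennreal \<delta> * (\<integral>\<^sup>+v. ennreal (1 / (\<delta> * v) * (\<delta> / (\<delta> * v)) ^ p) *
      indicator {1<..<2} (\<delta> / (\<delta> * v)) * indicator {0<..} (\<delta> * v) \<partial>lborel)"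
    using assms by (subst nn_integral_real_affine[where c = \<delta> and t = 0]) simp_all
  also have "\<dots> = (\<integral>\<^sup>+v. ennreal \<delta> * (ennreal (1 / (\<delta> * v) * (\<delta> / (\<delta> * v)) ^ p) *
      indicator {1<..<2} (\<delta> / (\<delta> * v)) * indicator {0<..} (\<delta> * v)) \<partial>lborel)"
    by (rule nn_integral_cmult[symmetric]) simp
  also have "\<dots> = shell_const p"
    unfolding shell_const_def
    by (rule nn_integral_cong)
      (use assms in \<open>auto simp: indicator_def zero_less_mult_iff power_add mult.assoc[symmetric]
        simp flip: ennreal_mult\<close>)
  finally show ?thesis .
qed

text \<open>Both integrals are obtained from
  \<open>\<integral> t\<^sup>p\<^sup>-\<^sup>1 \<delta>\<^sup>p exp (- t \<delta> b) dt = (p - 1)! / b\<^sup>p\<close> on the shell: after exchanging the integrals, the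
  substitution \<open>Y \<mapsto> Y / sqrt t\<close> moves the dilation \<open>t\<close> from the exponential to the shell.\<close>

lemma nn_integral_polar:
  fixes w :: "'k::real_or_complex^2^2 \<Rightarrow> ennreal" and b :: "'k^2^2 \<Rightarrow> real"
  assumes w [measurable]: "w \<in> borel_measurable borel" and b [measurable]: "b \<in> borel_measurable borel"
    and pos: "\<And>x. x \<in> pos_def_det1 \<Longrightarrow> b x > 0" and n: "n \<ge> 1"
  defines "p \<equiv> DIM('k) * n"
  shows "ennreal (fact (p - 1)) * (\<integral>\<^sup>+x. w x * ennreal (1 / b x ^ p) \<partial>shape_volume n) =
    shell_const p * (\<integral>\<^sup>+Y. indicator pos_def (gram n Y) * w (proj_det1 (gram n Y)) *
      ennreal (exp (- (sqrt (rc_re (det (gram n Y))) * b (proj_det1 (gram n Y))))) \<partial>lborel_family n)"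
proof -
  interpret product_sigma_finite "\<lambda>_::nat. lborel :: ('k^2) measure"
    by unfold_locales
  interpret finite_product_sigma_finite "\<lambda>_::nat. lborel :: ('k^2) measure" "{1..n}"
    by unfold_locales simp
  let ?L = "lborel_family n :: (nat \<Rightarrow> 'k^2) measure"
  interpret pair_sigma_finite "lborel :: real measure" ?L
    by unfold_locales
  have p: "p \<ge> 1"
    using n mult_le_mono[of 1 "DIM('k)" 1 n] DIM_positive[where 'a = 'k] by (simp add: p_def)
  define \<delta> where "\<delta> Y = sqrt (rc_re (det (gram n Y)))" for Y :: "nat \<Rightarrow> 'k^2"
  define \<beta> where "\<beta> Y = b (proj_det1 (gram n Y))" for Y
  define D where "D Y = indicator pos_def (gram n Y) * w (proj_det1 (gram n Y))" for Y
  define H where "H t Y = D Y * indicator {1<..<2} (\<delta> Y / t) *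
    ennreal ((\<delta> Y / t) ^ p * exp (- (\<delta> Y * \<beta> Y)))" for t :: real and Y
  define H' where "H' t Y = D Y * indicator {1<..<2} (\<delta> Y) *
    ennreal ((\<delta> Y) ^ p * exp (- (t * (\<delta> Y * \<beta> Y))))" for t :: real and Y
  have [measurable]: "\<delta> \<in> borel_measurable ?L" "\<beta> \<in> borel_measurable ?L" "D \<in> borel_measurable ?L"
    unfolding \<delta>_def \<beta>_def D_def by measurable
  have \<delta>_pos: "\<delta> Y > 0" and \<beta>_pos: "\<beta> Y > 0" if "gram n Y \<in> pos_def" for Y
    using that pos proj_det1_mem pos_def_det_pos by (auto simp: \<delta>_def \<beta>_def)
  \<comment> \<open>\<open>gram\<close> is quadratic, so dilating the frame by \<open>sqrt t\<close>
    multiplies the Gram matrix and \<open>\<delta>\<close> by \<open>t\<close> and leaves the shape,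
    hence \<open>\<beta>\<close>, unchanged.\<close>
  have H_scale: "H t (\<lambda>i\<in>{1..n}. sqrt t *\<^sub>R Y i) = H' t Y" if t: "t > 0" for t Y
  proof -
    have gram: "gram n (\<lambda>i\<in>{1..n}. sqrt t *\<^sub>R Y i) = t *\<^sub>R gram n Y"
      using t by (simp add: gram_scaleR)
    have "t *\<^sub>R gram n Y \<in> pos_def \<longleftrightarrow> gram n Y \<in> pos_def"
      using pos_def_scaleR[of "gram n Y" t] pos_def_scaleR[of "t *\<^sub>R gram n Y" "1 / t"] t by auto
    moreover have "\<delta> (\<lambda>i\<in>{1..n}. sqrt t *\<^sub>R Y i) = t * \<delta> Y"
      unfolding \<delta>_def gram using t by (simp add: det_scaleR real_sqrt_mult)
    ultimately show ?thesis
      using t by (auto simp: H_def H'_def D_def \<beta>_def gram proj_det1_scaleR indicator_def mult_ac)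
  qed
  have "ennreal (fact (p - 1)) * (\<integral>\<^sup>+x. w x * ennreal (1 / b x ^ p) \<partial>shape_volume n) =
      (\<integral>\<^sup>+Y. ennreal (fact (p - 1)) * (w (proj_det1 (gram n Y)) * ennreal (1 / \<beta> Y ^ p) *
        indicator (shell n) Y) \<partial>?L)"
    by (simp add: nn_integral_shape_volume nn_integral_cmult \<beta>_def)
  also have "\<dots> = (\<integral>\<^sup>+Y. \<integral>\<^sup>+t. ennreal (t ^ (p - 1)) * indicator {0<..} t * H' t Y \<partial>lborel \<partial>?L)"
  proof (rule nn_integral_cong)
    fix Y assume Y: "Y \<in> space ?L"
    show "ennreal (fact (p - 1)) * (w (proj_det1 (gram n Y)) * ennreal (1 / \<beta> Y ^ p) * indicator (shell n) Y) =
      (\<integral>\<^sup>+t. ennreal (t ^ (p - 1)) * indicator {0<..} t * H' t Y \<partial>lborel)"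
    proof (cases "Y \<in> shell n")
      case False
      then have "H' t Y = 0" for t
        using Y by (auto simp: H'_def D_def \<delta>_def shell_def indicator_def)
      with False show ?thesis
        by simp
    next
      case True
      then have Y': "gram n Y \<in> pos_def" "\<delta> Y \<in> {1<..<2}"
        by (auto simp: shell_def \<delta>_def)
      have "(\<integral>\<^sup>+t. ennreal (t ^ (p - 1)) * indicator {0<..} t * H' t Y \<partial>lborel) =
          (\<integral>\<^sup>+t. w (proj_det1 (gram n Y)) * ennreal (\<delta> Y ^ p) *
            (ennreal (t ^ (p - 1) * exp (- (t * (\<delta> Y * \<beta> Y)))) * indicator {0<..} t) \<partial>lborel)"
        using Y' by (intro nn_integral_cong)
          (auto simp: H'_def D_def indicator_def ennreal_mult mult_ac)
      also have "\<dots> = w (proj_det1 (gram n Y)) * ennreal (\<delta> Y ^ p) *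
          ennreal (fact (p - 1) / (\<delta> Y * \<beta> Y) ^ p)"
        using \<delta>_pos[OF Y'(1)] \<beta>_pos[OF Y'(1)] p
        by (subst nn_integral_cmult) (simp_all add: nn_integral_power_exp)
      also have "\<dots> = w (proj_det1 (gram n Y)) * ennreal (fact (p - 1) * (1 / \<beta> Y ^ p))"
        using \<delta>_pos[OF Y'(1)] \<beta>_pos[OF Y'(1)]
        by (simp add: mult.assoc power_mult_distrib flip: ennreal_mult)
      also have "\<dots> = w (proj_det1 (gram n Y)) * (ennreal (fact (p - 1)) * ennreal (1 / \<beta> Y ^ p))"
        using \<beta>_pos[OF Y'(1)] by (subst ennreal_mult) auto
      finally show ?thesis
        using True by (simp add: mult_ac)
    qed
  qed
  also have "\<dots> = (\<integral>\<^sup>+t. \<integral>\<^sup>+Y. ennreal (t ^ (p - 1)) * indicator {0<..} t * H' t Y \<partial>?L \<partial>lborel)"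
    unfolding H'_def by (rule Fubini') measurable
  also have "\<dots> = (\<integral>\<^sup>+t. \<integral>\<^sup>+Y. ennreal (1 / t) * indicator {0<..} t * H t Y \<partial>?L \<partial>lborel)"
  proof (rule nn_integral_cong)
    fix t :: real
    have [measurable]: "H t \<in> borel_measurable ?L" "H' t \<in> borel_measurable ?L"
      unfolding H_def H'_def by measurable
    show "(\<integral>\<^sup>+Y. ennreal (t ^ (p - 1)) * indicator {0<..} t * H' t Y \<partial>?L) =
      (\<integral>\<^sup>+Y. ennreal (1 / t) * indicator {0<..} t * H t Y \<partial>?L)"
    proof (cases "t > 0")
      case t: True
      have "(\<integral>\<^sup>+Y. H' t Y \<partial>?L) = (\<integral>\<^sup>+Y. H t (\<lambda>i\<in>{1..n}. sqrt t *\<^sub>R Y i) \<partial>?L)"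
        by (simp add: H_scale[OF t])
      also have "\<dots> = ennreal ((1 / sqrt t) ^ (DIM('k^2) * n)) * (\<integral>\<^sup>+Y. H t Y \<partial>?L)"
        using t by (intro nn_integral_lborel_family_scaleR) auto
      \<comment> \<open>A frame has real dimension \<open>2 * p\<close>, and the square root halves
        it: this is the source of the exponent \<open>kn\<close>. Together with
        \<open>t ^ (p - 1)\<close> it leaves the dilation-invariant weight
        \<open>1 / t\<close>.\<close>
      also have "(1 / sqrt t) ^ (DIM('k^2) * n) = 1 / t ^ p"
      proof -
        have "DIM('k^2) * n = 2 * p"
          by (simp add: p_def)
        show ?thesis
          unfolding \<open>DIM('k^2) * n = 2 * p\<close> using t by (simp add: power_mult power_divide)
      qed
      finally have "(\<integral>\<^sup>+Y. H' t Y \<partial>?L) = ennreal (1 / t ^ p) * (\<integral>\<^sup>+Y. H t Y \<partial>?L)" .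
      moreover have "t ^ (p - 1) * (1 / t ^ p) = 1 / t"
        using t p by (cases p) auto
      ultimately show ?thesis
        using t by (simp add: nn_integral_cmult mult.assoc[symmetric] flip: ennreal_mult)
    qed simp
  qed
  also have "\<dots> = (\<integral>\<^sup>+Y. \<integral>\<^sup>+t. ennreal (1 / t) * indicator {0<..} t * H t Y \<partial>lborel \<partial>?L)"
    unfolding H_def by (rule Fubini'[symmetric]) measurable
  also have "\<dots> = (\<integral>\<^sup>+Y. shell_const p * (D Y * ennreal (exp (- (\<delta> Y * \<beta> Y)))) \<partial>?L)"
  proof (rule nn_integral_cong)
    fix Y
    show "(\<integral>\<^sup>+t. ennreal (1 / t) * indicator {0<..} t * H t Y \<partial>lborel) =
      shell_const p * (D Y * ennreal (exp (- (\<delta> Y * \<beta> Y))))"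
    proof (cases "gram n Y \<in> pos_def")
      case False
      then show ?thesis
        by (simp add: H_def D_def)
    next
      case True
      have "(\<integral>\<^sup>+t. ennreal (1 / t) * indicator {0<..} t * H t Y \<partial>lborel) =
          (\<integral>\<^sup>+t. D Y * ennreal (exp (- (\<delta> Y * \<beta> Y))) *
            (ennreal (1 / t * (\<delta> Y / t) ^ p) * indicator {1<..<2} (\<delta> Y / t) * indicator {0<..} t) \<partial>lborel)"
      proof (rule nn_integral_cong)
        fix t :: real
        show "ennreal (1 / t) * indicator {0<..} t * H t Y = D Y * ennreal (exp (- (\<delta> Y * \<beta> Y))) *
            (ennreal (1 / t * (\<delta> Y / t) ^ p) * indicator {1<..<2} (\<delta> Y / t) * indicator {0<..} t)"
        proof (cases "t > 0")
          case t: True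
          then have "ennreal ((\<delta> Y / t) ^ p * exp (- (\<delta> Y * \<beta> Y))) =
              ennreal ((\<delta> Y / t) ^ p) * ennreal (exp (- (\<delta> Y * \<beta> Y)))"
            "ennreal (1 / t * (\<delta> Y / t) ^ p) = ennreal (1 / t) * ennreal ((\<delta> Y / t) ^ p)"
            using \<delta>_pos[OF True] by (intro ennreal_mult; simp)+
          then show ?thesis
            unfolding H_def by (simp only: mult_ac)
        qed simp
      qed
      also have "\<dots> = D Y * ennreal (exp (- (\<delta> Y * \<beta> Y))) * shell_const p"
        unfolding nn_integral_shell_scale[OF \<delta>_pos[OF True], symmetric]
        by (rule nn_integral_cmult) measurable
      finally show ?thesis
        by (simp add: mult_ac)
    qed
  qed
  also have "\<dots> = shell_const p * (\<integral>\<^sup>+Y. D Y * ennreal (exp (- (\<delta> Y * \<beta> Y))) \<partial>?L)"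
    by (rule nn_integral_cmult) simp
  finally show ?thesis
    by (simp add: D_def \<delta>_def \<beta>_def)
qed

subsection \<open>The projective Wishart density\<close>

text \<open>A real-valued \<open>g\<close> gives finite densities, so the factors stay sigma-finite
  and the product is determined by its values on boxes.\<close>

lemma PiM_density:
  fixes g :: "'a \<Rightarrow> real"
  assumes M: "sigma_finite_measure M" and g [measurable]: "g \<in> borel_measurable M" and I: "finite I"
  shows "(\<Pi>\<^sub>M i\<in>I. density M (\<lambda>x. ennreal (g x))) = density (\<Pi>\<^sub>M i\<in>I. M) (\<lambda>Y. \<Prod>i\<in>I. ennreal (g (Y i)))"
proof -
  interpret M: sigma_finite_measure M by (rule M)
  interpret M: product_sigma_finite "\<lambda>_. M"
    by unfold_locales
  interpret D: sigma_finite_measure "density M (\<lambda>x. ennreal (g x))"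
    by (subst M.sigma_finite_iff_density_finite) auto
  interpret D: product_sigma_finite "\<lambda>_. density M (\<lambda>x. ennreal (g x))"
    by unfold_locales
  have "density (\<Pi>\<^sub>M i\<in>I. M) (\<lambda>Y. \<Prod>i\<in>I. ennreal (g (Y i))) = (\<Pi>\<^sub>M i\<in>I. density M (\<lambda>x. ennreal (g x)))"
  proof (rule D.PiM_eqI[OF I])
    show "sets (density (\<Pi>\<^sub>M i\<in>I. M) (\<lambda>Y. \<Prod>i\<in>I. ennreal (g (Y i)))) =
        sets (\<Pi>\<^sub>M i\<in>I. density M (\<lambda>x. ennreal (g x)))"
      by (simp cong: sets_PiM_cong)
    fix A assume A: "\<And>i. i \<in> I \<Longrightarrow> A i \<in> sets (density M (\<lambda>x. ennreal (g x)))"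
    then have A' [measurable]: "\<And>i. i \<in> I \<Longrightarrow> A i \<in> sets M"
      by simp
    have "emeasure (density (\<Pi>\<^sub>M i\<in>I. M) (\<lambda>Y. \<Prod>i\<in>I. ennreal (g (Y i)))) (Pi\<^sub>E I A) =
        (\<integral>\<^sup>+Y. (\<Prod>i\<in>I. ennreal (g (Y i))) * indicator (Pi\<^sub>E I A) Y \<partial>(\<Pi>\<^sub>M i\<in>I. M))"
      using I A' by (intro emeasure_density) (auto intro!: sets_PiM_I_finite)
    also have "\<dots> = (\<integral>\<^sup>+Y. (\<Prod>i\<in>I. ennreal (g (Y i)) * indicator (A i) (Y i)) \<partial>(\<Pi>\<^sub>M i\<in>I. M))"
    proof (rule nn_integral_cong)
      fix Y assume "Y \<in> space (\<Pi>\<^sub>M i\<in>I. M)"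
      then have "indicator (Pi\<^sub>E I A) Y = (\<Prod>i\<in>I. indicator (A i) (Y i) :: ennreal)"
        using I by (auto simp: indicator_def space_PiM PiE_iff prod_zero_iff)
      then show "(\<Prod>i\<in>I. ennreal (g (Y i))) * indicator (Pi\<^sub>E I A) Y =
          (\<Prod>i\<in>I. ennreal (g (Y i)) * indicator (A i) (Y i))"
        by (simp add: prod.distrib)
    qed
    also have "\<dots> = (\<Prod>i\<in>I. \<integral>\<^sup>+x. ennreal (g x) * indicator (A i) x \<partial>M)"
      by (rule M.product_nn_integral_prod[OF I]) measurable
    also have "\<dots> = (\<Prod>i\<in>I. emeasure (density M (\<lambda>x. ennreal (g x))) (A i))"
      by (intro prod.cong refl) (simp add: emeasure_density)
    finally show "emeasure (density (\<Pi>\<^sub>M i\<in>I. M) (\<lambda>Y. \<Prod>i\<in>I. ennreal (g (Y i)))) (Pi\<^sub>E I A) =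
        (\<Prod>i\<in>I. emeasure (density M (\<lambda>x. ennreal (g x))) (A i))" .
  qed
  then show ?thesis ..
qed

lemma borel_measurable_quadratic [measurable]:
  "(\<lambda>y :: 'k::real_or_complex^2. y \<bullet> (A *v y)) \<in> borel_measurable borel"
  unfolding matrix_vector_mult_def by (intro borel_measurable_continuous_onI continuous_intros)

text \<open>The inverse of \<open>\<Sigma>\<close> is \<open>adjugate \<Sigma>\<close> over its
  determinant, so \<open>sum_inner_adjugate\<close> makes the joint density a function of the Gram
  matrix alone. \<open>N\<close> collects the normalizing constants.\<close>

lemma gaussian_family:
  fixes \<Sigma> :: "'k::real_or_complex^2^2"
  assumes \<Sigma>: "\<Sigma> \<in> pos_def"
  obtains N where "N > 0"
    "(\<Pi>\<^sub>M i\<in>{1..n}. gaussian \<Sigma>) = density (lborel_family n) (\<lambda>Y. ennreal (N *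
       exp (- (real DIM('k) / 2 / rc_re (det \<Sigma>) * rc_re (det_polar \<Sigma> (gram n Y))))))"
proof -
  define D where "D = rc_re (det \<Sigma>)"
  have D: "D > 0" "det \<Sigma> = of_real D"
    using pos_def_det_pos[OF \<Sigma>] hermitian_det_real[OF pos_def_hermitian[OF \<Sigma>]] by (auto simp: D_def)
  define N where "N = (real DIM('k) / (2 * pi)) ^ DIM('k) * D powr (- real DIM('k) / 2)"
  have N: "N > 0"
    using D by (auto simp: N_def)
  define q where "q y = exp (- (real DIM('k) / 2) * (y \<bullet> (matrix_inv \<Sigma> *v y)))" for y :: "'k^2"
  have q [measurable]: "q \<in> borel_measurable borel"
    unfolding q_def by measurable
  have inv: "matrix_inv \<Sigma> = (1 / D) *\<^sub>R adjugate \<Sigma>"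
  proof (rule matrix_inv_eq)
    have "(1 / D) *\<^sub>R mat (of_real D) = (mat 1 :: 'k^2^2)"
      using D(1) by (simp add: vec_eq_iff forall_2 mat_def matrix_scaleR_nth
          del: vector_scaleR_component flip: of_real_mult)
    then show "\<Sigma> ** ((1 / D) *\<^sub>R adjugate \<Sigma>) = mat 1" "((1 / D) *\<^sub>R adjugate \<Sigma>) ** \<Sigma> = mat 1"
      by (simp_all add: matrix_scaleR_left matrix_scaleR_right adjugate_mult D(2))
  qed
  have "((1 / D) *\<^sub>R adjugate \<Sigma>) *v y = (1 / D) *\<^sub>R (adjugate \<Sigma> *v y)" for y
    by (simp add: vec_eq_iff matrix_vector_mult_def sum_2 scaleR_add_right)
  then have quad: "y \<bullet> (matrix_inv \<Sigma> *v y) = (y \<bullet> (adjugate \<Sigma> *v y)) / D" for y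
    by (simp add: inv)
  have "gaussian \<Sigma> = density lborel (\<lambda>y. ennreal (N * q y))"
    by (simp add: gaussian_def N_def q_def D_def)
  then have "(\<Pi>\<^sub>M i\<in>{1..n}. gaussian \<Sigma>) =
      density (lborel_family n) (\<lambda>Y. \<Prod>i\<in>{1..n}. ennreal (N * q (Y i)))"
    by (simp add: PiM_density lborel.sigma_finite_measure_axioms)
  also have "(\<lambda>Y. \<Prod>i\<in>{1..n}. ennreal (N * q (Y i))) = (\<lambda>Y. ennreal (N ^ n *
       exp (- (real DIM('k) / 2 / D * rc_re (det_polar \<Sigma> (gram n Y))))))"
  proof
    fix Y :: "nat \<Rightarrow> 'k^2"
    have "(\<Prod>i\<in>{1..n}. ennreal (N * q (Y i))) = ennreal (\<Prod>i\<in>{1..n}. N * q (Y i))"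
      using N by (intro prod_ennreal) (auto simp: q_def)
    also have "(\<Prod>i\<in>{1..n}. N * q (Y i)) = N ^ n * exp (\<Sum>i=1..n. - (real DIM('k) / 2) * (Y i \<bullet> (matrix_inv \<Sigma> *v Y i)))"
      by (simp add: prod.distrib q_def exp_sum)
    also have "(\<Sum>i=1..n. - (real DIM('k) / 2) * (Y i \<bullet> (matrix_inv \<Sigma> *v Y i))) =
        - (real DIM('k) / 2 / D * rc_re (det_polar \<Sigma> (gram n Y)))"
      unfolding quad sum_inner_adjugate[symmetric]
      by (simp add: sum_negf sum_distrib_left sum_divide_distrib)
    finally show "(\<Prod>i\<in>{1..n}. ennreal (N * q (Y i))) = ennreal (N ^ n *
       exp (- (real DIM('k) / 2 / D * rc_re (det_polar \<Sigma> (gram n Y)))))" .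
  qed
  finally show thesis
    using that[of "N ^ n"] N by (simp add: D_def)
qed

lemma half_det_polar_pos:
  "x \<in> pos_def_det1 \<Longrightarrow> y \<in> pos_def_det1 \<Longrightarrow> rc_re (det_polar x y) / 2 > 0"
  using cosh_ai_dist[of x y] cosh_real_pos by metis

lemma det_polar_borel [measurable]:
  "(\<lambda>x :: 'k::real_or_complex^2^2. rc_re (det_polar A x)) \<in> borel_measurable borel"
  by (intro borel_measurable_continuous_onI continuous_intros)

lemma sets_proj_wishart: "sets (proj_wishart \<Sigma> n) = sets (restrict_space borel pos_def_det1)"
  by (simp add: proj_wishart_def)

text \<open>\<open>wishart\<close> restricts the law to \<open>pos_def\<close>, which is why
  positivity of the Gram matrix is part of the event.\<close>

lemma emeasure_proj_wishart:
  fixes \<Sigma> :: "'k::real_or_complex^2^2"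
  assumes A: "A \<in> sets borel" "A \<subseteq> pos_def_det1"
  shows "emeasure (proj_wishart \<Sigma> n) A =
    emeasure (\<Pi>\<^sub>M i\<in>{1..n}. gaussian \<Sigma>)
      {Y \<in> space (lborel_family n). gram n Y \<in> pos_def \<and> proj_det1 (gram n Y) \<in> A}"
proof -
  let ?P = "\<Pi>\<^sub>M i\<in>{1..n}. gaussian \<Sigma>"
  have sets_P: "sets ?P = sets (lborel_family n)"
    by (intro sets_PiM_cong) (auto simp: gaussian_def)
  then have space_P: "space ?P = space (lborel_family n)"
    by (rule sets_eq_imp_space_eq)
  have gram [measurable]: "gram n \<in> measurable ?P borel"
    using gram_measurable by (simp cong: measurable_cong_sets add: sets_P)
  have W: "wishart \<Sigma> n = restrict_space (distr ?P borel (gram n)) pos_def"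
    unfolding wishart_def gram_def[abs_def] ..
  have B: "proj_det1 -` A \<in> sets borel"
    using measurable_sets_borel[OF proj_det1_borel A(1)] .
  have "proj_det1 \<in> measurable (wishart \<Sigma> n) (restrict_space borel pos_def_det1)"
    unfolding W by (rule measurable_restrict_space3) (auto intro: proj_det1_mem)
  then have "emeasure (proj_wishart \<Sigma> n) A = emeasure (wishart \<Sigma> n) (proj_det1 -` A \<inter> space (wishart \<Sigma> n))"
    unfolding proj_wishart_def using A
    by (intro emeasure_distr) (auto simp: sets_restrict_space)
  also have "\<dots> = emeasure (distr ?P borel (gram n)) (proj_det1 -` A \<inter> pos_def)"
    unfolding W by (subst emeasure_restrict_space) (auto simp: space_restrict_space)
  also have "\<dots> = emeasure ?P (gram n -` (proj_det1 -` A \<inter> pos_def) \<inter> space ?P)"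
    using B by (intro emeasure_distr gram) auto
  also have "gram n -` (proj_det1 -` A \<inter> pos_def) \<inter> space ?P =
      {Y \<in> space (lborel_family n). gram n Y \<in> pos_def \<and> proj_det1 (gram n Y) \<in> A}"
    by (auto simp: space_P)
  finally show ?thesis .
qed

text \<open>By bilinearity the Gaussian exponent splits into \<open>\<delta>\<close> times
  \<open>\<kappa> * h\<close> of the shape. Then \<open>nn_integral_polar\<close> applies with
  \<open>w\<close> the indicator of \<open>A\<close> and \<open>b = \<kappa> * h\<close>, and the
  power of \<open>\<kappa>\<close> joins the constant.\<close>

lemma proj_wishart_shape_volume:
  fixes \<Sigma> :: "'k::real_or_complex^2^2"
  assumes \<Sigma>: "\<Sigma> \<in> pos_def" and n: "n \<ge> 1"
  defines "h \<equiv> \<lambda>x. rc_re (det_polar (proj_det1 \<Sigma>) x) / 2"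
  obtains a where "a > 0"
    "\<And>A. A \<in> sets borel \<Longrightarrow> A \<subseteq> pos_def_det1 \<Longrightarrow> emeasure (proj_wishart \<Sigma> n) A =
      ennreal a * (\<integral>\<^sup>+x. indicator A x * ennreal (1 / h x ^ (DIM('k) * n)) \<partial>shape_volume n)"
proof -
  let ?L = "lborel_family n :: (nat \<Rightarrow> 'k^2) measure"
  define p where "p = DIM('k) * n"
  define D where "D = rc_re (det \<Sigma>)"
  \<comment> \<open>The factor \<open>k / (2 D)\<close> of the exponent, times \<open>sqrt D\<close>
    from normalizing \<open>\<Sigma>\<close> and 2 from the definition of \<open>h\<close>.\<close>
  define \<kappa> where "\<kappa> = real DIM('k) / sqrt D"
  have D: "D > 0"
    using pos_def_det_pos[OF \<Sigma>] by (simp add: D_def)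
  have \<kappa>: "\<kappa> > 0"
    using D by (simp add: \<kappa>_def)
  obtain N where N: "N > 0" "(\<Pi>\<^sub>M i\<in>{1..n}. gaussian \<Sigma>) = density ?L (\<lambda>Y. ennreal (N *
       exp (- (real DIM('k) / 2 / D * rc_re (det_polar \<Sigma> (gram n Y))))))"
    using gaussian_family[OF \<Sigma>] unfolding D_def by metis
  have h_pos: "h x > 0" if "x \<in> pos_def_det1" for x
    using half_det_polar_pos[OF proj_det1_mem[OF \<Sigma>] that] by (simp add: h_def)
  have [measurable]: "h \<in> borel_measurable borel"
    unfolding h_def by measurable
  have exponent: "real DIM('k) / 2 / D * rc_re (det_polar \<Sigma> X) = sqrt (rc_re (det X)) * (\<kappa> * h (proj_det1 X))"
    if "X \<in> pos_def" for X
  proof -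
    have "rc_re (det_polar \<Sigma> X) =
        rc_re (det_polar (sqrt D *\<^sub>R proj_det1 \<Sigma>) (sqrt (rc_re (det X)) *\<^sub>R proj_det1 X))"
      using det_proj_det1[OF \<Sigma>] det_proj_det1[OF that] by (simp add: D_def)
    also have "\<dots> = sqrt (rc_re (det X)) * (sqrt D * (2 * h (proj_det1 X)))"
      by (simp add: det_polar_scaleR h_def)
    finally have "real DIM('k) / 2 / D * rc_re (det_polar \<Sigma> X) =
        sqrt (rc_re (det X)) * ((real DIM('k) * (sqrt D / D)) * h (proj_det1 X))"
      by simp
    also have "sqrt D / D = 1 / sqrt D"
      using D by (simp add: field_simps)
    finally show ?thesis
      by (simp add: \<kappa>_def)
  qed
  define c where "c = N * fact (p - 1) / (enn2real (shell_const p) * \<kappa> ^ p)"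
  have K: "shell_const p = ennreal (enn2real (shell_const p))" "enn2real (shell_const p) > 0"
    using shell_const[of p] by (auto simp: enn2real_positive_iff less_top zero_less_iff_neq_zero)
  have "c > 0"
    using N K \<kappa> by (auto simp: c_def)
  moreover have "emeasure (proj_wishart \<Sigma> n) A =
      ennreal c * (\<integral>\<^sup>+x. indicator A x * ennreal (1 / h x ^ p) \<partial>shape_volume n)"
    if A: "A \<in> sets borel" "A \<subseteq> pos_def_det1" for A
  proof -
    note A(1) [measurable]
    let ?B = "{Y \<in> space ?L. gram n Y \<in> pos_def \<and> proj_det1 (gram n Y) \<in> A}"
    define R where "R = (\<integral>\<^sup>+Y. indicator pos_def (gram n Y) * indicator A (proj_det1 (gram n Y)) *
        ennreal (exp (- (sqrt (rc_re (det (gram n Y))) * (\<kappa> * h (proj_det1 (gram n Y)))))) \<partial>?L)"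
    define V where "V = (\<integral>\<^sup>+x. indicator A x * ennreal (1 / h x ^ p) \<partial>shape_volume n)"
    have "emeasure (proj_wishart \<Sigma> n) A = (\<integral>\<^sup>+Y. ennreal (N *
        exp (- (real DIM('k) / 2 / D * rc_re (det_polar \<Sigma> (gram n Y))))) * indicator ?B Y \<partial>?L)"
      unfolding emeasure_proj_wishart[OF A] N(2) by (intro emeasure_density) measurable
    also have "\<dots> = (\<integral>\<^sup>+Y. ennreal N * (indicator pos_def (gram n Y) * indicator A (proj_det1 (gram n Y)) *
        ennreal (exp (- (sqrt (rc_re (det (gram n Y))) * (\<kappa> * h (proj_det1 (gram n Y))))))) \<partial>?L)"
    proof (rule nn_integral_cong)
      fix Y assume Y: "Y \<in> space ?L"
      show "ennreal (N * exp (- (real DIM('k) / 2 / D * rc_re (det_polar \<Sigma> (gram n Y))))) * indicator ?B Y =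
        ennreal N * (indicator pos_def (gram n Y) * indicator A (proj_det1 (gram n Y)) *
          ennreal (exp (- (sqrt (rc_re (det (gram n Y))) * (\<kappa> * h (proj_det1 (gram n Y)))))))"
      proof (cases "gram n Y \<in> pos_def")
        case True
        show ?thesis
          unfolding exponent[OF True] using N(1) Y True by (simp add: indicator_def ennreal_mult)
      qed simp
    qed
    also have "\<dots> = ennreal N * R"
      unfolding R_def by (rule nn_integral_cmult) measurable
    finally have PW: "emeasure (proj_wishart \<Sigma> n) A = ennreal N * R" .
    have "shell_const p * R = ennreal (fact (p - 1)) *
        (\<integral>\<^sup>+x. indicator A x * ennreal (1 / (\<kappa> * h x) ^ p) \<partial>shape_volume n)"
      unfolding R_def p_def by (rule nn_integral_polar[symmetric]) (use n \<kappa> h_pos in auto)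
    also have "(\<integral>\<^sup>+x. indicator A x * ennreal (1 / (\<kappa> * h x) ^ p) \<partial>shape_volume n) =
        (\<integral>\<^sup>+x. ennreal (1 / \<kappa> ^ p) * (indicator A x * ennreal (1 / h x ^ p)) \<partial>shape_volume n)"
    proof (rule nn_integral_cong)
      fix x
      show "indicator A x * ennreal (1 / (\<kappa> * h x) ^ p) =
          ennreal (1 / \<kappa> ^ p) * (indicator A x * ennreal (1 / h x ^ p))"
      proof (cases "x \<in> A")
        case True
        then have "h x > 0"
          using h_pos A(2) by blast
        then show ?thesis
          using True \<kappa> by (simp add: power_mult_distrib flip: ennreal_mult)
      qed simp
    qed
    also have "\<dots> = ennreal (1 / \<kappa> ^ p) * V"
      unfolding V_def
    proof (rule nn_integral_cmult)
      show "(\<lambda>x. indicator A x * ennreal (1 / h x ^ p)) \<in> borel_measurable (shape_volume n)"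
        unfolding measurable_cong_sets[OF sets_shape_volume refl]
        by (rule measurable_restrict_space1) measurable
    qed
    finally have KR: "shell_const p * R = ennreal (fact (p - 1)) * (ennreal (1 / \<kappa> ^ p) * V)" .
    define k where "k = enn2real (shell_const p)"
    have k: "shell_const p = ennreal k" "k > 0"
      using K by (auto simp: k_def)
    have "R = ennreal (1 / k) * (shell_const p * R)"
      using k by (simp add: mult.assoc[symmetric] flip: ennreal_mult)
    also have "\<dots> = ennreal (1 / k * (fact (p - 1) * (1 / \<kappa> ^ p))) * V"
      unfolding KR using k \<kappa> by (simp only: mult.assoc ennreal_mult zero_le_divide_iff zero_le_one
          zero_le_power less_imp_le mult_nonneg_nonneg fact_ge_zero simp_thms)
    finally have "emeasure (proj_wishart \<Sigma> n) A = ennreal N * ennreal (1 / k * (fact (p - 1) * (1 / \<kappa> ^ p))) * V"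
      unfolding PW by (simp only: mult.assoc)
    also have "ennreal N * ennreal (1 / k * (fact (p - 1) * (1 / \<kappa> ^ p))) = ennreal c"
      using N(1) k \<kappa> by (simp add: c_def k_def flip: ennreal_mult)
    finally show ?thesis
      by (simp add: V_def)
  qed
  ultimately show thesis
    using that unfolding p_def by blast
qed

section \<open>The shape volume is nonzero and uniform\<close>

lemma emeasure_lborel_open_pos:
  fixes U :: "'a::euclidean_space set"
  assumes "open U" "U \<noteq> {}"
  shows "emeasure lborel U \<noteq> 0"
proof -
  obtain x \<epsilon> where x: "\<epsilon> > 0" "ball x \<epsilon> \<subseteq> U"
    using assms by (metis all_not_in_conv openE)
  have "0 < emeasure lborel (ball x \<epsilon>)"
    using euclidean.uniform_kball_pos[OF uniform_lborel x(1), of x] by (simp add: euclidean_kball)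
  also have "\<dots> \<le> emeasure lborel U"
    using x(2) assms(1) by (intro emeasure_mono) auto
  finally show ?thesis
    by simp
qed

text \<open>The frames of \<open>gram_pos_def\<close> contain a product of nonempty open sets. Here
  \<open>n \<ge> 2\<close> enters: with fewer vectors every Gram matrix is singular.\<close>

lemma gram_pos_def_not_null:
  assumes n: "n \<ge> 2"
  shows "emeasure (lborel_family n :: (nat \<Rightarrow> 'k::real_or_complex^2) measure)
    {Y \<in> space (lborel_family n). gram n Y \<in> pos_def} \<noteq> 0"
proof -
  interpret product_sigma_finite "\<lambda>_::nat. lborel :: ('k^2) measure"
    by unfold_locales
  let ?L = "lborel_family n :: (nat \<Rightarrow> 'k^2) measure"
  define U where "U i = (if i = 1 then {y :: 'k^2. norm (y$2) < norm (y$1)}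
    else if i = 2 then {y. norm (y$1) < norm (y$2)} else UNIV)" for i :: nat
  have U: "open (U i)" "U i \<noteq> {}" for i
  proof -
    show "open (U i)"
      by (auto simp: U_def intro!: open_Collect_less continuous_intros)
    have "vector [1, 0] \<in> {y :: 'k^2. norm (y$2) < norm (y$1)}"
      "vector [0, 1] \<in> {y :: 'k^2. norm (y$1) < norm (y$2)}"
      by auto
    then show "U i \<noteq> {}"
      unfolding U_def by (metis UNIV_not_empty empty_iff)
  qed
  have "emeasure ?L (Pi\<^sub>E {1..n} U) = (\<Prod>i\<in>{1..n}. emeasure lborel (U i))"
    using U by (intro emeasure_PiM) auto
  also have "\<dots> \<noteq> 0"
    using emeasure_lborel_open_pos[OF U] by (simp add: prod_zero_iff)
  finally have "emeasure ?L (Pi\<^sub>E {1..n} U) \<noteq> 0" .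
  moreover have "Pi\<^sub>E {1..n} U \<subseteq> {Y \<in> space ?L. gram n Y \<in> pos_def}"
  proof
    fix Y assume Y: "Y \<in> Pi\<^sub>E {1..n} U"
    then have "Y 1 \<in> U 1" "Y 2 \<in> U 2"
      using n by (auto simp: PiE_iff)
    then have "gram n Y \<in> pos_def"
      by (intro gram_pos_def n) (auto simp: U_def)
    then show "Y \<in> {Y \<in> space ?L. gram n Y \<in> pos_def}"
      using Y by (auto simp: space_PiM PiE_iff)
  qed
  then have "emeasure ?L (Pi\<^sub>E {1..n} U) \<le> emeasure ?L {Y \<in> space ?L. gram n Y \<in> pos_def}"
    by (intro emeasure_mono) measurable
  ultimately show ?thesis
    by auto
qed

text \<open>For nonvanishing, \<open>nn_integral_polar\<close> with \<open>w = 1\<close> and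
  \<open>b = 1\<close> turns a zero volume into a zero integral of a positive function over the
  frames with positive definite Gram matrix, which are not null.\<close>

lemma uniform_shape_volume:
  assumes n: "n \<ge> 2"
  shows "det1.uniform (shape_volume n :: ('k::real_or_complex^2^2) measure)"
proof (rule uniform_if_congruence_invariant)
  let ?V = "shape_volume n :: ('k^2^2) measure" and ?L = "lborel_family n :: (nat \<Rightarrow> 'k^2) measure"
  show sets: "sets ?V = sets (restrict_space borel pos_def_det1)"
    by (rule sets_shape_volume)
  have space: "space ?V = pos_def_det1"
    using sets_eq_imp_space_eq[OF sets] by (simp add: space_restrict_space)
  show "emeasure ?V pos_def_det1 \<noteq> 0"
  proof
    assume 0: "emeasure ?V pos_def_det1 = 0"
    let ?F = "\<lambda>Y. indicator pos_def (gram n Y) * 1 *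
      ennreal (exp (- (sqrt (rc_re (det (gram n Y))) * 1)))"
    have "shell_const (DIM('k) * n) * (\<integral>\<^sup>+Y. ?F Y \<partial>?L) = ennreal (fact (DIM('k) * n - 1)) *
        (\<integral>\<^sup>+x. 1 * ennreal (1 / 1 ^ (DIM('k) * n)) \<partial>?V)"
      by (rule nn_integral_polar[symmetric]) (use n in auto)
    also have "\<dots> = 0"
      using 0 by (simp add: space)
    finally have "(\<integral>\<^sup>+Y. ?F Y \<partial>?L) = 0"
      using shell_const(1) by simp
    then have "AE Y in ?L. ?F Y = 0"
      by (subst (asm) nn_integral_0_iff_AE) measurable
    then have "AE Y in ?L. \<not> gram n Y \<in> pos_def"
      by eventually_elim (auto simp: indicator_def split: if_splits)
    then have "emeasure ?L {Y \<in> space ?L. \<not> \<not> gram n Y \<in> pos_def} = 0"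
      by (subst (asm) AE_iff_measurable[OF _ refl]) measurable
    then show False
      using gram_pos_def_not_null[OF n, where 'k = 'k] by simp
  qed
  show "emeasure ?V (det1.kball (mat 1) r) < \<infinity>" for r
    by (rule emeasure_shape_volume_kball_finite)
qed (rule emeasure_shape_volume_congruence)

text \<open>The constant \<open>C\<close> is a product: \<open>a\<close> relates the projective
  Wishart law to \<open>shape_volume n\<close>, and \<open>c\<close> relates
  \<open>shape_volume n\<close> to \<open>\<nu>\<close> by uniqueness of uniform measures.\<close>

lemma pw_density_cosh:
  fixes \<nu> :: "('k::real_or_complex^2^2) measure"
  assumes \<nu>: "invariant_volume \<nu>" and \<Sigma>: "\<Sigma> \<in> pos_def" and n: "n \<ge> 2"
  obtains C where "C > 0" "pw_density \<nu> \<Sigma> n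
    (\<lambda>x. C * cosh (ai_dist (1 / sqrt 2) x (proj_det1 \<Sigma>)) powi (- int (DIM('k) * n)))"
proof -
  define p where "p = DIM('k) * n"
  define h where "h x = rc_re (det_polar (proj_det1 \<Sigma>) x) / 2" for x
  have h_pos: "h x > 0" if "x \<in> pos_def_det1" for x
    using half_det_polar_pos[OF proj_det1_mem[OF \<Sigma>] that] by (simp add: h_def)
  have h_cosh: "cosh (ai_dist (1 / sqrt 2) x (proj_det1 \<Sigma>)) = h x" if "x \<in> pos_def_det1" for x
    using cosh_ai_dist[OF that proj_det1_mem[OF \<Sigma>]] by (simp add: h_def det_polar_commute)
  have [measurable]: "h \<in> borel_measurable borel"
    unfolding h_def by measurable
  note U = invariant_volume_uniform[OF \<nu>]
  obtain c where c: "c > 0" "shape_volume n = density \<nu> (\<lambda>_. ennreal c)"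
    using det1.uniform_proportional[OF uniform_shape_volume[OF n] U] by metis
  have "n \<ge> 1"
    using n by simp
  then obtain a where a: "a > 0"
    "\<And>A. A \<in> sets borel \<Longrightarrow> A \<subseteq> pos_def_det1 \<Longrightarrow> emeasure (proj_wishart \<Sigma> n) A =
      ennreal a * (\<integral>\<^sup>+x. indicator A x * ennreal (1 / h x ^ p) \<partial>shape_volume n)"
    using proj_wishart_shape_volume[OF \<Sigma>] unfolding h_def p_def by blast
  let ?f = "\<lambda>x. a * c * cosh (ai_dist (1 / sqrt 2) x (proj_det1 \<Sigma>)) powi (- int p)"
  \<comment> \<open>\<open>ai_dist\<close> rests on definite descriptions and is controlled only on
    \<open>pos_def_det1\<close>; measurability and continuity of \<open>?f\<close> are therefore
    transferred from this expression in the polynomial \<open>h\<close>.\<close>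
  have f_eq: "?f x = a * c * (1 / h x ^ p)" if "x \<in> pos_def_det1" for x
    using h_cosh[OF that] by (simp add: power_int_minus inverse_eq_divide)
  have meas: "f \<in> borel_measurable borel \<Longrightarrow> f \<in> borel_measurable \<nu>" for f :: "_ \<Rightarrow> ennreal"
    unfolding measurable_cong_sets[OF det1.uniformD(1)[OF U] refl] by (rule measurable_restrict_space1)
  have "proj_wishart \<Sigma> n = density \<nu> (\<lambda>x. ennreal (?f x))"
  proof (rule measure_eqI)
    show "sets (proj_wishart \<Sigma> n) = sets (density \<nu> (\<lambda>x. ennreal (?f x)))"
      by (simp add: sets_proj_wishart det1.uniformD(1)[OF U])
    fix A assume "A \<in> sets (proj_wishart \<Sigma> n)"
    then have A [measurable]: "A \<in> sets borel" and A': "A \<subseteq> pos_def_det1" "A \<in> sets \<nu>"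
      by (auto simp: sets_proj_wishart sets_restrict_space det1.uniformD(1)[OF U])
    have f_meas: "(\<lambda>x. ennreal (a * c * (1 / h x ^ p))) \<in> borel_measurable \<nu>"
      by (rule meas) measurable
    have "emeasure (proj_wishart \<Sigma> n) A =
        ennreal a * (\<integral>\<^sup>+x. ennreal c * (indicator A x * ennreal (1 / h x ^ p)) \<partial>\<nu>)"
      unfolding a(2)[OF A A'(1)] c(2)
      by (subst nn_integral_density) (auto intro!: meas)
    also have "\<dots> = (\<integral>\<^sup>+x. ennreal a * (ennreal c * (indicator A x * ennreal (1 / h x ^ p))) \<partial>\<nu>)"
      by (rule nn_integral_cmult[symmetric]) (rule meas, measurable)
    also have "\<dots> = (\<integral>\<^sup>+x. ennreal (a * c * (1 / h x ^ p)) * indicator A x \<partial>\<nu>)"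
    proof (rule nn_integral_cong)
      fix x
      show "ennreal a * (ennreal c * (indicator A x * ennreal (1 / h x ^ p))) =
          ennreal (a * c * (1 / h x ^ p)) * indicator A x"
      proof (cases "x \<in> A")
        case True
        then have "h x > 0"
          using h_pos A'(1) by blast
        then show ?thesis
          using True a(1) c(1) by (simp flip: ennreal_mult)
      qed simp
    qed
    also have "\<dots> = emeasure (density \<nu> (\<lambda>x. ennreal (a * c * (1 / h x ^ p)))) A"
      using f_meas A'(2) by (rule emeasure_density[symmetric])
    also have "density \<nu> (\<lambda>x. ennreal (a * c * (1 / h x ^ p))) = density \<nu> (\<lambda>x. ennreal (?f x))"
    proof (rule density_cong[OF f_meas])
      show "(\<lambda>x. ennreal (?f x)) \<in> borel_measurable \<nu>"
        using f_meas by (rule measurable_cong[THEN iffD1, rotated]) (simp add: det1.uniformD(3)[OF U] f_eq)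
      show "AE x in \<nu>. ennreal (a * c * (1 / h x ^ p)) = ennreal (?f x)"
        by (rule AE_I2) (simp add: det1.uniformD(3)[OF U] f_eq)
    qed
    finally show "emeasure (proj_wishart \<Sigma> n) A = emeasure (density \<nu> (\<lambda>x. ennreal (?f x))) A" .
  qed
  moreover have "continuous_on pos_def_det1 ?f"
  proof -
    have "continuous_on pos_def_det1 (\<lambda>x. a * c * (1 / h x ^ p))"
      unfolding h_def using h_pos by (intro continuous_intros) (force simp: h_def)+
    then show ?thesis
      by (rule continuous_on_cong[THEN iffD1, rotated 2]) (auto simp: f_eq)
  qed
  ultimately have "pw_density \<nu> \<Sigma> n ?f"
    using a(1) c(1) by (simp add: pw_density_def)
  then show thesis
    using that[of "a * c"] a(1) c(1) by (simp add: p_def)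
qed

text \<open>Densities of the same law agree almost everywhere. Where two continuous ones differ is
  relatively open, so if nonempty it contains a ball, and balls have positive measure.\<close>

lemma pw_density_unique:
  fixes \<nu> :: "('k::real_or_complex^2^2) measure"
  assumes \<nu>: "invariant_volume \<nu>" and f: "pw_density \<nu> \<Sigma> n f" and g: "pw_density \<nu> \<Sigma> n g"
    and x: "x \<in> pos_def_det1"
  shows "f x = g x"
proof (rule ccontr)
  assume ne: "f x \<noteq> g x"
  note U = invariant_volume_uniform[OF \<nu>]
  interpret sigma_finite_measure \<nu>
    by (rule det1.uniform_sigma_finite[OF U])
  have cont: "continuous_on pos_def_det1 f" "continuous_on pos_def_det1 g"
    using f g by (auto simp: pw_density_def)
  then have meas: "f \<in> borel_measurable \<nu>" "g \<in> borel_measurable \<nu>"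
    unfolding measurable_cong_sets[OF det1.uniformD(1)[OF U] refl]
    by (auto intro: borel_measurable_continuous_on_restrict)
  have "density \<nu> (\<lambda>x. ennreal (f x)) = density \<nu> (\<lambda>x. ennreal (g x))"
    using f g by (simp add: pw_density_def)
  then have "AE x in \<nu>. ennreal (f x) = ennreal (g x)"
    using meas by (subst (asm) density_unique_iff) auto
  \<comment> \<open>\<open>ennreal\<close> is injective only on nonnegative reals;
    \<open>pw_density\<close> demands that both functions be nonnegative.\<close>
  then have ae: "AE x in \<nu>. f x = g x"
    using AE_space by eventually_elim (use f g in \<open>auto simp: det1.uniformD(3)[OF U] pw_density_def\<close>)
  have "openin (top_of_set pos_def_det1) (pos_def_det1 \<inter> (\<lambda>x. f x - g x) -` (- {0}))"
    using cont by (intro continuous_openin_preimage_gen continuous_intros) auto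
  then obtain V where V: "open V" "pos_def_det1 \<inter> (\<lambda>x. f x - g x) -` (- {0}) = pos_def_det1 \<inter> V"
    unfolding openin_open by metis
  have "x \<in> V \<inter> pos_def_det1"
    using V(2) x ne by auto
  then obtain r where r: "r > 0" "\<And>y. y \<in> pos_def_det1 \<Longrightarrow> rc_re (det_polar x y) - 2 < r \<Longrightarrow> y \<in> V"
    using det1.kernel_nhds[OF V(1)] by metis
  have "AE y in \<nu>. y \<notin> det1.kball x r"
    using ae AE_space
  proof eventually_elim
    case (elim y)
    have "y \<notin> pos_def_det1 \<inter> (\<lambda>x. f x - g x) -` (- {0})"
      using elim(1) by simp
    then show ?case
      unfolding V(2) using r(2)[of y] by (auto simp: det1.kball_def)
  qed
  then have "det1.kball x r \<in> null_sets \<nu>"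
    using AE_iff_null_sets[OF det1.kball_sets[OF U x]] by blast
  then have "emeasure \<nu> (det1.kball x r) = 0"
    by (rule null_setsD1)
  then show False
    using det1.uniform_kball_pos[OF U r(1) x] by simp
qed

text \<open>Existence is included so that the claim about all continuous densities is not vacuous;
  \<open>pw_density_unique\<close> carries the explicit formula over to any of them.\<close>

lemma pw_density_proportional:
  fixes \<nu> :: "('k::real_or_complex^2^2) measure"
  assumes "invariant_volume \<nu>" "\<Sigma> \<in> pos_def" "n > 2"
  shows "(\<exists>f. pw_density \<nu> \<Sigma> n f) \<and>
    (\<forall>f. pw_density \<nu> \<Sigma> n f \<longrightarrow> (\<exists>C>0. \<forall>x\<in>pos_def_det1.
      f x = C * cosh (ai_dist (1 / sqrt 2) x (proj_det1 \<Sigma>)) powi (- int (DIM('k) * n))))"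
proof -
  obtain C where C: "C > 0" "pw_density \<nu> \<Sigma> n
      (\<lambda>x. C * cosh (ai_dist (1 / sqrt 2) x (proj_det1 \<Sigma>)) powi (- int (DIM('k) * n)))"
    using pw_density_cosh[of \<nu> \<Sigma> n] assms by auto
  then show ?thesis
    using pw_density_unique[OF assms(1) _ C(2)] by blast
qed

theorem theorem3:
  "(\<exists>c>0. \<forall>\<nu> :: (real^2^2) measure. invariant_volume \<nu> \<longrightarrow>
      (\<forall>\<Sigma>\<in>pos_def. \<forall>n::nat. n > 2 \<longrightarrow>
        (\<exists>f. pw_density \<nu> \<Sigma> n f) \<and>
        (\<forall>f. pw_density \<nu> \<Sigma> n f \<longrightarrow>
          (\<exists>C>0. \<forall>x\<in>pos_def_det1.
             f x = C * cosh (ai_dist c x (proj_det1 \<Sigma>)) powi (- int (1 * n)))))) \<and>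
   (\<exists>c>0. \<forall>\<nu> :: (complex^2^2) measure. invariant_volume \<nu> \<longrightarrow>
      (\<forall>\<Sigma>\<in>pos_def. \<forall>n::nat. n > 2 \<longrightarrow>
        (\<exists>f. pw_density \<nu> \<Sigma> n f) \<and>
        (\<forall>f. pw_density \<nu> \<Sigma> n f \<longrightarrow>
          (\<exists>C>0. \<forall>x\<in>pos_def_det1.
             f x = C * cosh (ai_dist c x (proj_det1 \<Sigma>)) powi (- int (2 * n))))))"
proof (rule conjI; rule exI[of _ "1 / sqrt 2"]; rule conjI)
  show "1 / sqrt 2 > (0::real)" "1 / sqrt 2 > (0::real)"
    by simp_all
qed (use pw_density_proportional[where 'k = real, unfolded DIM_real]
    pw_density_proportional[where 'k = complex, unfolded DIM_complex] in blast)+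

end
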